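(* Let $n\ge1$, let $m$ be a positive integer, and let $\eta=(\eta_1,\dots,\eta_n)$ be a vector of integers or of half-integers with $m>\eta_1>\dots>\eta_n\ge0$. Then, as $k\to\infty$, the number of walks on the $m$-circle which start at $\eta$ and consist of exactly $k$ diagonal steps (arbitrary end point), such that at no time two coordinates of a point of the walk are equal, is asymptotically $$\frac{2^{\binom n2}}{m^{n/2}}\left(2^n\prod_{j=1}^n\cos\frac{\pi(j-\frac{n+1}2)}{m}\right)^k\prod_{1\le h<t\le n}\sin\frac{\pi(\eta_h-\eta_t)}{m}\prod_{h=1}^{n/2}\cot\frac{(2h-1)\pi}{2m}$$ if $n$ is even, and asymptotically $$\frac{2^{\binom n2}}{m^{(n-1)/2}}\left(2^n\prod_{j=1}^n\cos\frac{\pi(j-\frac{n+1}2)}{m}\right)^k\prod_{1\le h<t\le n}\sin\frac{\pi(\eta_h-\eta_t)}{m}\prod_{h=1}^{(n-1)/2}\cot\frac{h\pi}{m}$$ if $n$ is odd.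
   Context: A half-integer is an odd integer divided by $2$. Walks on the $m$-circle are walks in $n$-space where each coordinate is taken modulo $m$. A walk with $k$ diagonal steps is a sequence $p_0,\dots,p_k$ of such points with $p_i-p_{i-1}\in\{(\pm\frac12,\dots,\pm\frac12)\}$; the condition is that for every $i$ and $h\ne t$ the $h$-th and $t$-th coordinates of $p_i$ are distinct modulo $m$. "Asymptotically $E$" means the ratio of the count to $E$ tends to $1$. *)

theory Defs
  imports "HOL-Library.FuncSet" "HOL-Library.Real_Mod"
begin

definition half_integer :: "real \<Rightarrow> bool" where
  "half_integer x \<longleftrightarrow> (\<exists>a::int. odd a \<and> x = of_int a / 2)"

text \<open>Points of \<open>n\<close>-space are functions on \<open>{1..n}\<close>, and walks are sequences indexed by \<open>{0..k}\<close>;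
  the extensional function spaces make them determined by their values there, so that the sets of
  walks below can be counted.\<close>

definition points :: "nat \<Rightarrow> (nat \<Rightarrow> real) set" where
  "points n = ({1..n} \<rightarrow>\<^sub>E UNIV)"

definition diagonal_walks :: "nat \<Rightarrow> nat \<Rightarrow> (nat \<Rightarrow> nat \<Rightarrow> real) set" where
  "diagonal_walks n k = {p \<in> {0..k} \<rightarrow>\<^sub>E points n.
     \<forall>i\<in>{1..k}. \<forall>h\<in>{1..n}. p i h - p (i - 1) h \<in> {-1/2, 1/2}}"

text \<open>Coordinates are read modulo \<open>m\<close> only in the non-collision condition. A walk with coordinates
  taken modulo \<open>m\<close>, starting at \<open>\<eta>\<close> and given by its steps, has exactly one such lift to \<open>n\<close>-space
  starting at \<open>\<eta>\<close> itself. Working with the lift also keeps the steps \<open>1/2\<close> and \<open>-1/2\<close> distinct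
  when \<open>m = 1\<close>.\<close>

definition circle_walks :: "nat \<Rightarrow> nat \<Rightarrow> (nat \<Rightarrow> real) \<Rightarrow> nat \<Rightarrow> (nat \<Rightarrow> nat \<Rightarrow> real) set" where
  "circle_walks n m \<eta> k = {p \<in> diagonal_walks n k.
     (\<forall>h\<in>{1..n}. p 0 h = \<eta> h) \<and>
     (\<forall>i\<in>{0..k}. \<forall>h\<in>{1..n}. \<forall>t\<in>{1..n}. h \<noteq> t \<longrightarrow> \<not> [p i h = p i t] (rmod real m))}"

definition circle_walks_asymptotics :: "nat \<Rightarrow> nat \<Rightarrow> (nat \<Rightarrow> real) \<Rightarrow> nat \<Rightarrow> real" where
  "circle_walks_asymptotics n m \<eta> k =
     (if even n then
        2 ^ (n choose 2) / real m ^ (n div 2)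
        * (2 ^ n * (\<Prod>j=1..n. cos (pi * (real j - (real n + 1) / 2) / real m))) ^ k
        * (\<Prod>h=1..n. \<Prod>t\<in>{h<..n}. sin (pi * (\<eta> h - \<eta> t) / real m))
        * (\<Prod>h=1..n div 2. cot ((2 * real h - 1) * pi / (2 * real m)))
      else
        2 ^ (n choose 2) / real m ^ ((n - 1) div 2)
        * (2 ^ n * (\<Prod>j=1..n. cos (pi * (real j - (real n + 1) / 2) / real m))) ^ k
        * (\<Prod>h=1..n. \<Prod>t\<in>{h<..n}. sin (pi * (\<eta> h - \<eta> t) / real m))
        * (\<Prod>h=1..(n - 1) div 2. cot (real h * pi / real m)))"

end

theory Submission
  imports Defs "Jordan_Normal_Form.Determinant" "HOL-Combinatorics.Permutations"
begin

text \<open>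
  After a shift the walks live on \<open>\<int>\<^sup>n\<close> and every coordinate moves by \<open>0\<close> or \<open>1\<close>. The function
  \<open>F x = \<Prod>\<^sub>h\<^sub><\<^sub>t sgn (sin (\<pi> (x\<^sub>h - x\<^sub>t) / m))\<close> is antisymmetric, is multiplied by \<open>(-1)\<^sup>n\<^sup>+\<^sup>1\<close> when a
  coordinate is translated by \<open>m\<close>, and is constant along collision-free walks. By the reflection
  principle, summing \<open>F\<close> over the end points of all free walks therefore counts the collision-free
  ones up to sign. Expanding \<open>F\<close> into plane waves diagonalises the free walk: a wave with momenta
  \<open>r\<^sub>1, \<dots>, r\<^sub>n\<close> is multiplied by \<open>\<Prod> (1 + cis (2 \<pi> r\<^sub>i / m))\<close> in each step, antisymmetry leaves only
  distinct momenta, and the largest modulus belongs to the momenta centred at \<open>0\<close> alone. These waves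
  combine into a Vandermonde determinant, the product of the \<open>sin (\<pi> (\<eta>\<^sub>h - \<eta>\<^sub>t) / m)\<close>. Their Fourier
  coefficient is evaluated with the Pfaffian-like expansion of a product of signs: since the
  centred momenta are symmetric, only the pairs \<open>r, -r\<close> contribute, each with a factor \<open>cot (\<pi> r / m)\<close>.
\<close>

section \<open>The Vandermonde determinant\<close>

lemma prod_pairs_Suc:
  fixes f :: "nat \<Rightarrow> nat \<Rightarrow> 'a::comm_monoid_mult"
  shows "(\<Prod>i<Suc n. \<Prod>j\<in>{i<..<Suc n}. f i j) = (\<Prod>i<n. \<Prod>j\<in>{i<..<n}. f i j) * (\<Prod>i<n. f i n)"
proof -
  have "(\<Prod>i<Suc n. \<Prod>j\<in>{i<..<Suc n}. f i j) = (\<Prod>i<n. f i n * (\<Prod>j\<in>{i<..<n}. f i j)) * (\<Prod>j\<in>{n<..<Suc n}. f n j)"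
  proof -
    have "(\<Prod>j\<in>{i<..<Suc n}. f i j) = f i n * (\<Prod>j\<in>{i<..<n}. f i j)" if "i < n" for i
    proof -
      have "{i<..<Suc n} = insert n {i<..<n}" using that by auto
      then show ?thesis by simp
    qed
    then show ?thesis by simp
  qed
  moreover have "{n<..<Suc n} = {}" by auto
  ultimately show ?thesis by (simp add: prod.distrib mult.commute)
qed

definition vandermonde_mat :: "nat \<Rightarrow> (nat \<Rightarrow> 'a::comm_ring_1) \<Rightarrow> 'a mat" where
  "vandermonde_mat n z = mat n n (\<lambda>(i, j). z i ^ j)"

lemma vandermonde_mat_carrier [simp]: "vandermonde_mat n z \<in> carrier_mat n n"
  by (simp add: vandermonde_mat_def)

text \<open>Replace the last node by a variable \<open>x\<close>. Laplace expansion along the last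
  row makes the determinant a polynomial in \<open>x\<close> of degree at most \<open>n\<close>. Its
  top coefficient is the smaller Vandermonde determinant, and it vanishes at the other nodes, where
  two rows coincide.\<close>

lemma det_vandermonde_mat:
  fixes z :: "nat \<Rightarrow> 'a::idom"
  shows "det (vandermonde_mat n z) = (\<Prod>i<n. \<Prod>j\<in>{i<..<n}. z j - z i)"
proof (induction n arbitrary: z)
  case 0
  then show ?case by (simp add: vandermonde_mat_def det_def)
next
  case (Suc n)
  define A where "A = (\<lambda>x. vandermonde_mat (Suc n) (z(n := x)))"
  define c where "c = (\<lambda>j. cofactor (A 0) n j)"
  have A[simp]: "A x \<in> carrier_mat (Suc n) (Suc n)" for x
    by (simp add: A_def)
  have c: "cofactor (A x) n j = c j" if "j \<le> n" for x j
  proof -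
    have "mat_delete (A x) n j = mat_delete (A 0) n j"
      by (rule eq_matI) (auto simp: mat_delete_def A_def vandermonde_mat_def)
    then show ?thesis by (simp add: c_def cofactor_def)
  qed
  have det_A: "det (A x) = (\<Sum>j\<le>n. c j * x ^ j)" for x
  proof -
    have "det (A x) = (\<Sum>j<Suc n. A x $$ (n, j) * cofactor (A x) n j)"
      by (rule laplace_expansion_row) auto
    also have "\<dots> = (\<Sum>j\<le>n. c j * x ^ j)"
      unfolding lessThan_Suc_atMost by (intro sum.cong refl) (simp add: c, simp add: A_def vandermonde_mat_def)
    finally show ?thesis .
  qed
  have cn: "c n = (\<Prod>i<n. \<Prod>j\<in>{i<..<n}. z j - z i)"
  proof -
    have "mat_delete (A 0) n n = vandermonde_mat n z"
      by (rule eq_matI) (auto simp: mat_delete_def A_def vandermonde_mat_def)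
    then show ?thesis using Suc.IH[of z] by (simp add: c_def cofactor_def)
  qed
  have "det (vandermonde_mat (Suc n) z) = det (A (z n))"
    by (simp add: A_def)
  also have "\<dots> = c n * (\<Prod>i<n. z n - z i)"
  proof (cases "inj_on z {..<n}")
    case True
    define p where "p = (\<Sum>j\<le>n. monom (c j) j)"
    define q where "q = smult (c n) (\<Prod>i<n. [:- z i, 1:])"
    have dq: "degree (\<Prod>i<n. [:- z i, 1:]) = n"
      by (simp add: degree_prod_eq_sum_degree)
    have lq: "lead_coeff (\<Prod>i<n. [:- z i, 1:]) = 1"
      unfolding lead_coeff_prod by simp
    have coeff_p: "coeff p n = c n"
      by (simp add: p_def coeff_sum)
    have "p = q"
    \<comment> \<open>Both polynomials have degree at most \<open>n\<close> and the same coefficient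
      at \<open>n\<close>, so agreement at \<open>n\<close> distinct nodes suffices.\<close>
    proof (rule poly_eqI_degree_lead_coeff)
      show "degree p \<le> n" unfolding p_def
        by (intro degree_sum_le) (auto intro: order.trans[OF degree_monom_le])
      show "degree q \<le> n" unfolding q_def
        using dq by (metis degree_smult_le)
      show "coeff p n = coeff q n" using dq lq by (simp add: coeff_p q_def)
      show "card (z ` {..<n}) \<ge> n" using True by (simp add: card_image)
    next
      fix w assume "w \<in> z ` {..<n}"
      then obtain i where i: "i < n" "w = z i" by auto
      have "poly p w = det (A w)"
        by (simp add: det_A p_def poly_sum poly_monom)
      also have "\<dots> = 0"
        by (rule det_identical_rows[where i = i and j = n and n = "Suc n"])
          (use i in \<open>auto simp: A_def vandermonde_mat_def intro!: eq_vecI\<close>)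
      also have "\<dots> = poly q w"
        using i by (auto simp: q_def poly_prod)
      finally show "poly p w = poly q w" .
    qed
    then have "poly p (z n) = poly q (z n)" by simp
    then show ?thesis by (simp add: p_def q_def poly_sum poly_prod poly_monom det_A)
  next
    \<comment> \<open>With repeated nodes there are too few points to interpolate, but both sides
      are zero: two rows agree, and \<open>c n\<close> contains a vanishing difference.\<close>
    case False
    then obtain i j where ij: "i < n" "j < n" "z i = z j" "i < j"
      by (metis inj_onI lessThan_iff linorder_neqE_nat)
    have "det (A (z n)) = 0"
      by (rule det_identical_rows[where i = i and j = j and n = "Suc n"])
        (use ij in \<open>auto simp: A_def vandermonde_mat_def intro!: eq_vecI\<close>)
    moreover have "(\<Prod>j\<in>{i<..<n}. z j - z i) = 0"
      by (rule prod_zero) (use ij in auto)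
    then have "\<exists>i\<in>{..<n}. (\<Prod>j\<in>{i<..<n}. z j - z i) = 0"
      using ij by (intro bexI[of _ i]) auto
    then have "c n = 0" unfolding cn
      by (rule prod_zero[OF finite_lessThan])
    ultimately show ?thesis by simp
  qed
  finally show ?case by (simp only: prod_pairs_Suc cn)
qed

section \<open>Products of signs\<close>

text \<open>For injective \<open>y\<close> this is the sign of the permutation that sorts the values
  into decreasing order; a tie gives 0.\<close>

definition sgn_prod :: "('a::linorder \<Rightarrow> int) \<Rightarrow> 'a set \<Rightarrow> int" where
  "sgn_prod y B = (\<Prod>h\<in>B. \<Prod>t\<in>{t \<in> B. h < t}. sgn (y h - y t))"

text \<open>The alternating sign of a row expansion, with positions in \<open>B\<close> counted from
  0.\<close>

definition rank_sign :: "'a::linorder set \<Rightarrow> 'a \<Rightarrow> int" where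
  "rank_sign B j = (-1) ^ card {i \<in> B. i < j}"

lemma sgn_prod_cong: "(\<And>i. i \<in> B \<Longrightarrow> y i = y' i) \<Longrightarrow> sgn_prod y B = sgn_prod y' B"
  by (auto simp: sgn_prod_def intro!: prod.cong)

lemma sgn_prod_empty [simp]: "sgn_prod y {} = 1"
  by (simp add: sgn_prod_def)

text \<open>Each index of \<open>B\<close> below \<open>k\<close> contributes its pair with
  \<open>k\<close> in the opposite orientation. Reversing these pairs costs one sign each, in total
  \<open>rank_sign B k\<close>.\<close>

lemma sgn_prod_insert:
  assumes "finite B" "k \<notin> B"
  shows "sgn_prod y (insert k B) = rank_sign B k * (\<Prod>i\<in>B. sgn (y k - y i)) * sgn_prod y B"
proof -
  have "(\<Prod>h\<in>B. \<Prod>t\<in>{t \<in> insert k B. h < t}. sgn (y h - y t))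
      = (\<Prod>h\<in>B. (if h < k then sgn (y h - y k) else 1) * (\<Prod>t\<in>{t \<in> B. h < t}. sgn (y h - y t)))"
  proof (rule prod.cong [OF refl])
    fix h assume "h \<in> B"
    have "{t \<in> insert k B. h < t} = (if h < k then insert k {t \<in> B. h < t} else {t \<in> B. h < t})"
      by auto
    then show "(\<Prod>t\<in>{t \<in> insert k B. h < t}. sgn (y h - y t))
        = (if h < k then sgn (y h - y k) else 1) * (\<Prod>t\<in>{t \<in> B. h < t}. sgn (y h - y t))"
      using assms by simp
  qed
  also have "\<dots> = (\<Prod>h\<in>B. if h < k then sgn (y h - y k) else 1) * sgn_prod y B"
    by (simp add: prod.distrib sgn_prod_def)
  finally have "(\<Prod>h\<in>B. \<Prod>t\<in>{t \<in> insert k B. h < t}. sgn (y h - y t))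
      = (\<Prod>h\<in>B. if h < k then sgn (y h - y k) else 1) * sgn_prod y B" .
  moreover have "{t \<in> insert k B. k < t} = {t \<in> B. k < t}" by auto
  ultimately have 1: "sgn_prod y (insert k B) = (\<Prod>t\<in>{t \<in> B. k < t}. sgn (y k - y t))
      * (\<Prod>h\<in>B. if h < k then sgn (y h - y k) else 1) * sgn_prod y B"
    using assms by (subst sgn_prod_def) (simp add: mult.assoc)
  have 2: "(\<Prod>h\<in>B. if h < k then sgn (y h - y k) else 1) = rank_sign B k * (\<Prod>h\<in>{h \<in> B. h < k}. sgn (y k - y h))"
  proof -
    have "(\<Prod>h\<in>B. if h < k then sgn (y h - y k) else 1) = (\<Prod>h\<in>{h \<in> B. h < k}. sgn (y h - y k))"
      using assms by (simp add: prod.inter_filter)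
    also have "\<dots> = (\<Prod>h\<in>{h \<in> B. h < k}. - 1 * sgn (y k - y h))"
      by (intro prod.cong refl) (simp add: sgn_if)
    finally show ?thesis unfolding rank_sign_def prod.distrib by simp
  qed
  have "B = {t \<in> B. k < t} \<union> {h \<in> B. h < k}"
    using assms(2) by (auto dest: neqE) (metis linorder_neqE)
  then have "(\<Prod>i\<in>B. sgn (y k - y i)) = (\<Prod>i\<in>{t \<in> B. k < t} \<union> {h \<in> B. h < k}. sgn (y k - y i))"
    by metis
  also have "\<dots> = (\<Prod>i\<in>{t \<in> B. k < t}. sgn (y k - y i)) * (\<Prod>i\<in>{h \<in> B. h < k}. sgn (y k - y i))"
    using assms by (intro prod.union_disjoint) auto
  finally show ?thesis by (simp add: 1 2)
qed

lemma sgn_prod_eq_0: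
  assumes "finite B" "i \<in> B" "j \<in> B" "i \<noteq> j" "y i = y j"
  shows "sgn_prod y B = 0"
proof -
  have B: "B = insert i (B - {i})" using assms by auto
  have "(\<Prod>l\<in>B - {i}. sgn (y i - y l)) = 0"
    using assms by (intro prod_zero bexI[of _ j]) auto
  then show ?thesis using assms by (subst B, subst sgn_prod_insert) auto
qed

text \<open>Induction on the largest element \<open>M\<close>. Adding \<open>M\<close> flips every
  old summand, and the new summand is \<open>sgn (x - M)\<close>. With \<open>P\<close> the product
  over the old set, the claim becomes \<open>(sgn (x - M) + 1) * (1 - P) = 0\<close>: the first
  factor vanishes for \<open>x < M\<close>, the second for \<open>x \<ge> M\<close>.\<close>

lemma sum_sgn_prod_distinct:
  fixes Y :: "int set"
  assumes "finite Y"
  shows "(\<Sum>t\<in>Y. sgn (x - t) * (\<Prod>i\<in>Y - {t}. sgn (t - i))) = (\<Prod>t\<in>Y. sgn (x - t)) - of_bool (even (card Y))"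
  using assms
proof (induction Y rule: finite_linorder_max_induct)
  case empty
  then show ?case by simp
next
  case (insert M Y)
  have M: "M \<notin> Y" using insert by auto
  have "(\<Sum>t\<in>Y. sgn (x - t) * (\<Prod>i\<in>insert M Y - {t}. sgn (t - i)))
      = (\<Sum>t\<in>Y. - (sgn (x - t) * (\<Prod>i\<in>Y - {t}. sgn (t - i))))"
  proof (rule sum.cong [OF refl])
    fix t assume t: "t \<in> Y"
    then have "insert M Y - {t} = insert M (Y - {t})" "M \<notin> Y - {t}" "t < M" using M insert by auto
    then show "sgn (x - t) * (\<Prod>i\<in>insert M Y - {t}. sgn (t - i)) = - (sgn (x - t) * (\<Prod>i\<in>Y - {t}. sgn (t - i)))"
      using insert by simp
  qed
  also have "\<dots> = of_bool (even (card Y)) - (\<Prod>t\<in>Y. sgn (x - t))"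
    by (simp add: sum_negf insert.IH)
  finally have 1: "(\<Sum>t\<in>Y. sgn (x - t) * (\<Prod>i\<in>insert M Y - {t}. sgn (t - i)))
      = of_bool (even (card Y)) - (\<Prod>t\<in>Y. sgn (x - t))" .
  have 2: "(\<Prod>i\<in>Y. sgn (M - i)) = 1"
    using insert by (auto intro!: prod.neutral)
  have diff: "insert M Y - {M} = Y" using M by auto
  have 3: "(\<Prod>t\<in>Y. sgn (x - t)) = 1" if "x \<ge> M"
    using insert that by (intro prod.neutral) force
  have "x > M \<or> x = M \<or> x < M" by auto
  then show ?case using M insert(1) 3
    by (subst sum.insert) (auto simp: 1 2 diff card_insert_disjoint)
qed

text \<open>For \<open>x\<close> above all values of \<open>y\<close> this expands a Pfaffian of odd size bordered by ones,
  for \<open>x = y a\<close> with \<open>a\<close> below \<open>B\<close> it expands the Pfaffian of \<open>sgn (y h - y t)\<close> along row \<open>a\<close>.\<close>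

lemma sgn_prod_expansion:
  fixes y :: "'a::linorder \<Rightarrow> int"
  assumes fin: "finite B" and odd: "odd (card B)"
  shows "(\<Sum>j\<in>B. rank_sign B j * sgn (x - y j) * sgn_prod y (B - {j})) = sgn_prod y B * (\<Prod>t\<in>B. sgn (x - y t))"
proof (cases "inj_on y B")
  case True
  \<comment> \<open>Without ties the signs are invertible, so deleting \<open>j\<close> amounts to
    multiplying by the signs of \<open>j\<close> against the rest. The sum then depends only on the
    set of values of \<open>y\<close>.\<close>
  have "rank_sign B j * sgn_prod y (B - {j}) = sgn_prod y B * (\<Prod>i\<in>B - {j}. sgn (y j - y i))" if j: "j \<in> B" for j
  proof -
    let ?Q = "\<Prod>i\<in>B - {j}. sgn (y j - y i)"
    have sq: "?Q * ?Q = 1"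
      unfolding prod.distrib[symmetric]
    proof (rule prod.neutral, rule ballI)
      fix i assume "i \<in> B - {j}"
      then have "y i \<noteq> y j" using True j by (auto dest: inj_onD)
      then show "sgn (y j - y i) * sgn (y j - y i) = 1" by (auto simp: sgn_if)
    qed
    have "B = insert j (B - {j})" using j by auto
    then have "sgn_prod y B = rank_sign (B - {j}) j * ?Q * sgn_prod y (B - {j})"
      using fin by (metis Diff_iff finite_Diff insertI1 sgn_prod_insert)
    moreover have "{i \<in> B - {j}. i < j} = {i \<in> B. i < j}" by auto
    then have "rank_sign (B - {j}) j = rank_sign B j" by (simp add: rank_sign_def)
    ultimately have "sgn_prod y B * ?Q = (?Q * ?Q) * (rank_sign B j * sgn_prod y (B - {j}))"
      by (simp add: algebra_simps)
    then show ?thesis unfolding sq by simp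
  qed
  then have "(\<Sum>j\<in>B. rank_sign B j * sgn (x - y j) * sgn_prod y (B - {j}))
      = sgn_prod y B * (\<Sum>j\<in>B. sgn (x - y j) * (\<Prod>i\<in>B - {j}. sgn (y j - y i)))"
    unfolding sum_distrib_left by (intro sum.cong refl) (simp add: algebra_simps)
  also have "(\<Sum>j\<in>B. sgn (x - y j) * (\<Prod>i\<in>B - {j}. sgn (y j - y i)))
      = (\<Sum>t\<in>y ` B. sgn (x - t) * (\<Prod>i\<in>y ` B - {t}. sgn (t - i)))"
  proof (subst sum.reindex[OF True], rule sum.cong[OF refl])
    fix j assume j: "j \<in> B"
    have "y ` B - {y j} = y ` (B - {j})" "inj_on y (B - {j})" using True j
      by (auto simp: inj_on_def)
    then show "sgn (x - y j) * (\<Prod>i\<in>B - {j}. sgn (y j - y i)) =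
        ((\<lambda>t. sgn (x - t) * (\<Prod>i\<in>y ` B - {t}. sgn (t - i))) \<circ> y) j"
      by (simp add: prod.reindex)
  qed
  also have "\<dots> = (\<Prod>t\<in>B. sgn (x - y t))"
    using True odd fin by (subst sum_sgn_prod_distinct) (auto simp: card_image prod.reindex)
  finally show ?thesis .
next
  case False
  then obtain j k where jk: "j \<in> B" "k \<in> B" "j < k" "y j = y k"
    by (metis inj_onI linorder_neqE)
  \<comment> \<open>A summand that keeps both \<open>j\<close> and \<open>k\<close> still contains
    the tie and is zero. The two summands deleting \<open>j\<close> or \<open>k\<close> cancel:
    \<open>j\<close> lies below \<open>k\<close>, which reverses the rank sign of \<open>k\<close>
    relative to \<open>C\<close> but not that of \<open>j\<close>.\<close>
  define C where "C = B - {j, k}"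
  have C: "finite C" "j \<notin> C" "k \<notin> C" "B = insert j (insert k C)"
    using fin jk by (auto simp: C_def)
  have 0: "rank_sign B i * sgn (x - y i) * sgn_prod y (B - {i}) = 0" if "i \<in> C" for i
    using sgn_prod_eq_0[of "B - {i}" j k y] fin jk C that by auto
  have "{i \<in> B. i < j} = {i \<in> C. i < j}" using C jk by auto
  then have rj: "rank_sign B j = rank_sign C j" by (simp add: rank_sign_def)
  have rk: "rank_sign B k = - rank_sign C k"
  proof -
    have "{i \<in> B. i < k} = insert j {i \<in> C. i < k}" using C jk by auto
    then show ?thesis using C by (simp add: rank_sign_def)
  qed
  have Bj: "B - {j} = insert k C" and Bk: "B - {k} = insert j C" using C jk by auto
  have "(\<Sum>i\<in>B. rank_sign B i * sgn (x - y i) * sgn_prod y (B - {i}))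
     = (\<Sum>i\<in>insert j (insert k C). rank_sign B i * sgn (x - y i) * sgn_prod y (B - {i}))"
    using C by metis
  also have "\<dots> = rank_sign B j * sgn (x - y j) * sgn_prod y (B - {j}) + rank_sign B k * sgn (x - y k) * sgn_prod y (B - {k})"
  proof -
    have "j \<notin> insert k C" using C jk by auto
    moreover have "(\<Sum>i\<in>C. rank_sign B i * sgn (x - y i) * sgn_prod y (B - {i})) = 0"
      using 0 by (rule sum.neutral[OF ballI])
    ultimately show ?thesis using C(1,3) by (simp only: sum.insert finite_insert add_0_right simp_thms)
  qed
  also have "\<dots> = 0"
    unfolding rj rk Bj Bk sgn_prod_insert[OF C(1,2)] sgn_prod_insert[OF C(1,3)] jk(4) by (simp add: algebra_simps)
  finally show ?thesis using sgn_prod_eq_0[of B j k y] fin jk by simp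
qed

section \<open>Pfaffian expansions for sums of weighted sign products\<close>

lemma sum_PiE_insert:
  assumes "j \<notin> B"
  shows "(\<Sum>y\<in>insert j B \<rightarrow>\<^sub>E S. f y) = (\<Sum>v\<in>S. \<Sum>y\<in>B \<rightarrow>\<^sub>E S. f (y(j := v)))"
proof -
  have "(\<Sum>y\<in>insert j B \<rightarrow>\<^sub>E S. f y) = (\<Sum>(v, y)\<in>S \<times> (B \<rightarrow>\<^sub>E S). f (y(j := v)))"
    unfolding PiE_insert_eq
    using inj_combinator[OF assms, of "\<lambda>_. S"]
    by (subst sum.reindex) (simp_all add: case_prod_unfold o_def)
  also have "\<dots> = (\<Sum>v\<in>S. \<Sum>y\<in>B \<rightarrow>\<^sub>E S. f (y(j := v)))"
    by (simp add: sum.cartesian_product)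
  finally show ?thesis .
qed

text \<open>For \<open>A\<close> of even size this is the Pfaffian with entries
  \<open>sgn_pair_sum S (w i) (w j)\<close>; only its row expansion is used below.\<close>

definition sgn_prod_sum :: "int set \<Rightarrow> ('a::linorder \<Rightarrow> int \<Rightarrow> complex) \<Rightarrow> 'a set \<Rightarrow> complex" where
  "sgn_prod_sum S w A = (\<Sum>y\<in>A \<rightarrow>\<^sub>E S. of_int (sgn_prod y A) * (\<Prod>i\<in>A. w i (y i)))"

definition sgn_pair_sum :: "int set \<Rightarrow> (int \<Rightarrow> complex) \<Rightarrow> (int \<Rightarrow> complex) \<Rightarrow> complex" where
  "sgn_pair_sum S f g = (\<Sum>u\<in>S. \<Sum>v\<in>S. of_int (sgn (u - v)) * f u * g v)"

lemma sum_PiE_split_off: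
  assumes "finite B" "j \<in> B"
  shows "(\<Sum>y\<in>B \<rightarrow>\<^sub>E S. c (y j) * of_int (sgn_prod y (B - {j})) * (\<Prod>i\<in>B. w i (y i)))
    = (\<Sum>v\<in>S. c v * w j v) * sgn_prod_sum S w (B - {j})"
proof -
  have "(\<Sum>y\<in>B \<rightarrow>\<^sub>E S. c (y j) * of_int (sgn_prod y (B - {j})) * (\<Prod>i\<in>B. w i (y i)))
    = (\<Sum>v\<in>S. \<Sum>y\<in>B - {j} \<rightarrow>\<^sub>E S. c v * of_int (sgn_prod (y(j := v)) (B - {j}))
        * (\<Prod>i\<in>B. w i ((y(j := v)) i)))"
    using sum_PiE_insert[of j "B - {j}" "\<lambda>y. c (y j) * of_int (sgn_prod y (B - {j})) * (\<Prod>i\<in>B. w i (y i))" S]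
    by (simp add: insert_absorb[OF assms(2)])
  also have "\<dots> = (\<Sum>v\<in>S. \<Sum>y\<in>B - {j} \<rightarrow>\<^sub>E S. (c v * w j v) *
      (of_int (sgn_prod y (B - {j})) * (\<Prod>i\<in>B - {j}. w i (y i))))"
  proof (intro sum.cong refl)
    fix v y
    have "sgn_prod (y(j := v)) (B - {j}) = sgn_prod y (B - {j})"
      by (rule sgn_prod_cong) auto
    moreover have "(\<Prod>i\<in>B. w i ((y(j := v)) i)) = w j v * (\<Prod>i\<in>B - {j}. w i (y i))"
      using assms by (subst prod.remove[of _ j]) auto
    ultimately show "c v * of_int (sgn_prod (y(j := v)) (B - {j})) * (\<Prod>i\<in>B. w i ((y(j := v)) i))
       = (c v * w j v) * (of_int (sgn_prod y (B - {j})) * (\<Prod>i\<in>B - {j}. w i (y i)))"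
      by simp
  qed
  finally show ?thesis
    by (simp only: sgn_prod_sum_def sum_product)
qed

text \<open>The sign expansion is taken at \<open>x = M\<close>, above all values, where every
  \<open>sgn (x - y j)\<close> is 1. Index \<open>j\<close> then decouples and leaves the plain sum
  of its weight.\<close>

lemma sgn_prod_sum_odd:
  assumes "finite B" "odd (card B)" and S: "\<And>v. v \<in> S \<Longrightarrow> v < M"
  shows "sgn_prod_sum S w B = (\<Sum>j\<in>B. of_int (rank_sign B j) * (\<Sum>v\<in>S. w j v) * sgn_prod_sum S w (B - {j}))"
proof -
  have "sgn_prod y B = (\<Sum>j\<in>B. rank_sign B j * sgn_prod y (B - {j}))" if y: "y \<in> B \<rightarrow>\<^sub>E S" for y
  proof -
    have "sgn (M - y j) = 1" if "j \<in> B" for j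
      using S[OF PiE_mem[OF y that]] by simp
    then show ?thesis using sgn_prod_expansion[OF assms(1,2), of M y] by simp
  qed
  then have "sgn_prod_sum S w B =
      (\<Sum>j\<in>B. \<Sum>y\<in>B \<rightarrow>\<^sub>E S. of_int (rank_sign B j * sgn_prod y (B - {j})) * (\<Prod>i\<in>B. w i (y i)))"
    unfolding sgn_prod_sum_def by (subst sum.swap) (simp add: sum_distrib_right)
  also have "\<dots> = (\<Sum>j\<in>B. of_int (rank_sign B j) * (\<Sum>v\<in>S. w j v) * sgn_prod_sum S w (B - {j}))"
    using sum_PiE_split_off[OF assms(1), where S = S and w = w and c = "\<lambda>_. 1"]
    by (intro sum.cong refl) (simp add: mult.assoc flip: sum_distrib_left)
  finally show ?thesis .
qed

text \<open>The sign expansion is taken at \<open>x = y a\<close>. As \<open>a\<close> precedes all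
  of \<open>B\<close>, its signs against \<open>B\<close> complete \<open>sgn_prod y B\<close> to
  the product over \<open>insert a B\<close> without a rank sign.\<close>

lemma sgn_prod_sum_even:
  assumes "finite B" "odd (card B)" and a: "\<And>i. i \<in> B \<Longrightarrow> a < i"
  shows "sgn_prod_sum S w (insert a B) =
    (\<Sum>j\<in>B. of_int (rank_sign B j) * sgn_pair_sum S (w a) (w j) * sgn_prod_sum S w (B - {j}))"
proof -
  have a': "a \<notin> B" using a by blast
  have "{i \<in> B. i < a} = {}" using a by fastforce
  then have ra: "rank_sign B a = 1" by (simp only: rank_sign_def) simp
  have eq: "sgn_prod (y(a := u)) (insert a B) * (\<Prod>i\<in>insert a B. w i ((y(a := u)) i))
     = w a u * (\<Sum>j\<in>B. of_int (rank_sign B j) * (of_int (sgn (u - y j)) * of_int (sgn_prod y (B - {j})) * (\<Prod>i\<in>B. w i (y i))))"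
    for y u
  proof -
    have "sgn_prod (y(a := u)) (insert a B) = (\<Prod>i\<in>B. sgn (u - y i)) * sgn_prod y B"
      using assms(1) a' ra by (auto simp: sgn_prod_insert intro!: arg_cong2[where f = "(*)"] prod.cong sgn_prod_cong)
    also have "\<dots> = (\<Sum>j\<in>B. rank_sign B j * sgn (u - y j) * sgn_prod y (B - {j}))"
      using sgn_prod_expansion[OF assms(1,2), of u y] by simp
    finally have 1: "sgn_prod (y(a := u)) (insert a B) = (\<Sum>j\<in>B. rank_sign B j * sgn (u - y j) * sgn_prod y (B - {j}))" .
    have 2: "(\<Prod>i\<in>insert a B. w i ((y(a := u)) i)) = w a u * (\<Prod>i\<in>B. w i (y i))"
      using assms(1) a' by (auto intro!: prod.cong)
    show ?thesis unfolding 1 2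
      by (simp add: sum_distrib_left sum_distrib_right algebra_simps)
  qed
  have "sgn_prod_sum S w (insert a B) = (\<Sum>u\<in>S. \<Sum>y\<in>B \<rightarrow>\<^sub>E S.
      sgn_prod (y(a := u)) (insert a B) * (\<Prod>i\<in>insert a B. w i ((y(a := u)) i)))"
    unfolding sgn_prod_sum_def by (rule sum_PiE_insert[OF a'])
  also have "\<dots> = (\<Sum>u\<in>S. w a u * (\<Sum>j\<in>B. of_int (rank_sign B j) * 
      (\<Sum>y\<in>B \<rightarrow>\<^sub>E S. of_int (sgn (u - y j)) * of_int (sgn_prod y (B - {j})) * (\<Prod>i\<in>B. w i (y i)))))"
    unfolding eq sum_distrib_left by (intro sum.cong refl sum.swap)
  also have "\<dots> = (\<Sum>u\<in>S. w a u * (\<Sum>j\<in>B. of_int (rank_sign B j) * 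
      ((\<Sum>v\<in>S. of_int (sgn (u - v)) * w j v) * sgn_prod_sum S w (B - {j}))))"
    using sum_PiE_split_off[OF assms(1), where S = S and w = w and c = "\<lambda>v. of_int (sgn (_ - v))"] by simp
  also have "\<dots> = (\<Sum>j\<in>B. of_int (rank_sign B j) * sgn_pair_sum S (w a) (w j) * sgn_prod_sum S w (B - {j}))"
    unfolding sum_distrib_left sum_distrib_right sgn_pair_sum_def
    by (subst sum.swap) (intro sum.cong refl, simp add: sum_distrib_left sum_distrib_right algebra_simps)
  finally show ?thesis .
qed

section \<open>Geometric sums against a sign kernel\<close>

lemma sum_int_lessThan: "(\<Sum>u\<in>{0..<int m}. f u) = (\<Sum>u<m. f (int u))"
  by (rule sum.reindex_bij_witness[of _ int nat]) auto

lemma sum_root_of_unity: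
  fixes z :: complex
  assumes "z ^ m = 1" "z \<noteq> 1"
  shows "(\<Sum>u<m. z ^ u) = 0"
  using assms by (simp add: geometric_sum)

text \<open>The inner sum over \<open>v\<close> is a multiple of \<open>z' ^ u\<close> plus a term
  independent of \<open>u\<close>. Summed against \<open>z ^ u\<close>, that second term yields
  exactly the product assumed to vanish.\<close>

lemma sgn_pair_sum_geometric:
  fixes z z' :: complex
  assumes z': "z' \<noteq> 1" and *: "(1 + z' ^ m) * (\<Sum>u<m. z ^ u) = 0"
  shows "sgn_pair_sum {0..<int m} (\<lambda>u. z ^ nat u) (\<lambda>u. z' ^ nat u) = (z' + 1) / (z' - 1) * (\<Sum>u<m. (z * z') ^ u)"
proof -
  have inner: "(\<Sum>v<m. of_int (sgn (int u - int v)) * z' ^ v) = (z' ^ u * (z' + 1) - (1 + z' ^ m)) / (z' - 1)" if u: "u < m" for u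
  proof -
    have "{..<m} = {..<u} \<union> {u..<m}" using u by auto
    then have "(\<Sum>v<m. of_int (sgn (int u - int v)) * z' ^ v)
      = (\<Sum>v<u. of_int (sgn (int u - int v)) * z' ^ v) + (\<Sum>v\<in>{u..<m}. of_int (sgn (int u - int v)) * z' ^ v)"
      by (simp add: sum.union_disjoint ivl_disj_int)
    \<comment> \<open>The diagonal term \<open>v = u\<close> carries the sign 0.\<close>
    also have "(\<Sum>v\<in>{u..<m}. of_int (sgn (int u - int v)) * z' ^ v) = (\<Sum>v\<in>{Suc u..<m}. of_int (sgn (int u - int v)) * z' ^ v)"
      using u by (simp add: sum.atLeast_Suc_lessThan)
    also have "\<dots> = - (\<Sum>v\<in>{Suc u..<m}. z' ^ v)"
      unfolding sum_negf[symmetric] by (intro sum.cong refl) auto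
    also have "(\<Sum>v\<in>{Suc u..<m}. z' ^ v) = (\<Sum>v<m. z' ^ v) - (\<Sum>v<Suc u. z' ^ v)"
      using u sum_diff_nat_ivl[of 0 "Suc u" m "\<lambda>v. z' ^ v"] by (simp only: lessThan_atLeast0)
    also have "(\<Sum>v<u. of_int (sgn (int u - int v)) * z' ^ v) = (\<Sum>v<u. z' ^ v)"
      by (intro sum.cong refl) auto
    finally have "(\<Sum>v<m. of_int (sgn (int u - int v)) * z' ^ v)
        = (z' ^ u - 1) / (z' - 1) - ((z' ^ m - 1) / (z' - 1) - (z' ^ Suc u - 1) / (z' - 1))"
      by (simp only: geometric_sum[OF z']) simp
    also have "\<dots> = (z' ^ u * (z' + 1) - (1 + z' ^ m)) / (z' - 1)"
      by (simp only: diff_divide_distrib[symmetric]) (simp add: algebra_simps)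
    finally show ?thesis .
  qed
  have "sgn_pair_sum {0..<int m} (\<lambda>u. z ^ nat u) (\<lambda>u. z' ^ nat u)
      = (\<Sum>u<m. z ^ u * (\<Sum>v<m. of_int (sgn (int u - int v)) * z' ^ v))"
    unfolding sgn_pair_sum_def sum_int_lessThan by (simp add: sum_distrib_left algebra_simps)
  also have "\<dots> = (\<Sum>u<m. (z' + 1) / (z' - 1) * (z * z') ^ u - (1 + z' ^ m) / (z' - 1) * z ^ u)"
  proof (intro sum.cong refl)
    fix u assume "u \<in> {..<m}"
    then have "z ^ u * (\<Sum>v<m. of_int (sgn (int u - int v)) * z' ^ v) = z ^ u * ((z' ^ u * (z' + 1) - (1 + z' ^ m)) / (z' - 1))"
      by (simp only: inner lessThan_iff)
    also have "\<dots> = (z' + 1) / (z' - 1) * (z * z') ^ u - (1 + z' ^ m) / (z' - 1) * z ^ u"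
      by (simp add: power_mult_distrib diff_divide_distrib add_divide_distrib algebra_simps)
    finally show "z ^ u * (\<Sum>v<m. of_int (sgn (int u - int v)) * z' ^ v)
      = (z' + 1) / (z' - 1) * (z * z') ^ u - (1 + z' ^ m) / (z' - 1) * z ^ u" .
  qed
  also have "\<dots> = (z' + 1) / (z' - 1) * (\<Sum>u<m. (z * z') ^ u) - (1 + z' ^ m) / (z' - 1) * (\<Sum>u<m. z ^ u)"
    by (simp add: sum_subtractf sum_distrib_left)
  finally show ?thesis using * by simp
qed

section \<open>Plane waves on the circle\<close>

lemma cis_eq_1_imp_multiple:
  fixes m :: nat
  assumes "cis (2 * pi * s / real m) = 1" "m > 0"
  obtains k :: int where "s = of_int k * real m"
proof -
  have "cos (2 * pi * s / real m) = 1"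
    using assms by (metis cis.simps(1) one_complex.simps(1))
  then obtain k :: int where "2 * pi * s / real m = of_int k * 2 * pi"
    unfolding cos_one_2pi_int by blast
  then have "pi * s = pi * (of_int k * real m)"
    using assms by (simp add: field_simps)
  then have "s = of_int k * real m"
    by (simp only: mult_left_cancel[OF pi_neq_zero])
  then show ?thesis by (rule that)
qed

text \<open>The bound \<open>n \<le> m\<close> holds whenever \<open>n\<close> coordinates are
  distinct modulo \<open>m\<close>. It puts the momenta with \<open>u < n\<close> strictly between
  \<open>-m/2\<close> and \<open>m/2\<close>.\<close>

locale circle =
  fixes n m :: nat
  assumes n_le_m: "n \<le> m" and m_pos: "m > 0"
begin

text \<open>The shift centres the momenta with \<open>u < n\<close> at 0: negation is
  \<open>u \<mapsto> n - 1 - u\<close>. They are integers for odd \<open>n\<close> and half-integers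
  for even \<open>n\<close>.\<close>

definition momentum :: "nat \<Rightarrow> real" where
  "momentum u = real u - (real n - 1) / 2"

definition wave :: "nat \<Rightarrow> int \<Rightarrow> complex" where
  "wave u d = cis (2 * pi * momentum u * of_int d / real m)"

lemma wave_0 [simp]: "wave u 0 = 1"
  by (simp add: wave_def)

lemma wave_add: "wave u (a + b) = wave u a * wave u b"
  by (simp add: wave_def cis_mult add_divide_distrib distrib_left)

lemma wave_neg_eq_power: "wave u (- int k) = wave u (-1) ^ k"
  by (simp add: wave_def DeMoivre mult_ac)

text \<open>All momenta agree modulo 1, so one turn around the circle gives the same sign for each:
  waves are periodic for odd \<open>n\<close> and antiperiodic for even \<open>n\<close>.\<close>

lemma wave_neg_power_m: "wave u (-1) ^ m = (-1) ^ (n + 1)"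
proof -
  have "real m * (2 * pi * momentum u * of_int (-1) / real m) = pi * (real n - 1) + 2 * pi * real_of_int (- int u)"
    using m_pos by (simp add: momentum_def field_simps)
  then have "wave u (-1) ^ m = cis (pi * (real n - 1)) * cis (2 * pi * real_of_int (- int u))"
    by (simp only: wave_def DeMoivre cis_mult)
  also have "cis (2 * pi * real_of_int (- int u)) = 1"
    by (rule cis_multiple_2pi) simp
  also have "cis (pi * (real n - 1)) = cis (pi * real (n + 1)) * cis (2 * pi * real_of_int (-1))"
    by (simp add: cis_mult algebra_simps)
  also have "cis (2 * pi * real_of_int (-1)) = 1"
    by (rule cis_multiple_2pi) simp
  also have "cis (pi * real (n + 1)) * 1 = cis (real (n + 1) * pi)"
    by (simp only: mult.commute[of pi] mult_1_right)
  also have "\<dots> = (-1) ^ (n + 1)"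
    by (simp only: DeMoivre[symmetric] cis_pi)
  finally show ?thesis by simp
qed

lemma cis_momentum_neq_1:
  assumes "s \<noteq> 0" "\<bar>s\<bar> < real m"
  shows "cis (2 * pi * s * of_int (-1) / real m) \<noteq> 1"
proof
  assume "cis (2 * pi * s * of_int (-1) / real m) = 1"
  then have "cis (2 * pi * (- s) / real m) = 1" by simp
  then obtain k :: int where s: "- s = of_int k * real m"
    using cis_eq_1_imp_multiple m_pos by blast
  then have "\<bar>of_int k\<bar> * real m < 1 * real m"
    using assms by (metis abs_minus_cancel abs_mult abs_of_nat mult_1)
  then have "\<bar>of_int k :: real\<bar> < 1" using m_pos by (simp only: mult_less_cancel_right)
  then have "k = 0" by linarith
  then show False using s assms by simp
qed

lemma wave_neg_neq_1:
  assumes "u < n" "2 * u + 1 \<noteq> n"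
  shows "wave u (-1) \<noteq> 1"
proof -
  have b: "2 * \<bar>momentum u\<bar> \<le> real n - 1" "momentum u \<noteq> 0"
    using assms by (auto simp: momentum_def abs_if field_simps)
  have "\<bar>momentum u\<bar> < real m" using b n_le_m by linarith
  then have "cis (2 * pi * momentum u * of_int (-1) / real m) \<noteq> 1"
    using b by (intro cis_momentum_neq_1)
  then show ?thesis by (simp only: wave_def not_False_eq_True)
qed

lemma wave_pair_neq_1:
  assumes "u < n" "v < n" "u + v + 1 \<noteq> n"
  shows "wave u (-1) * wave v (-1) \<noteq> 1"
proof -
  have sum: "momentum u + momentum v = real u + real v + 1 - real n"
    by (simp add: momentum_def field_simps)
  then have s: "\<bar>momentum u + momentum v\<bar> \<le> real n - 1" "momentum u + momentum v \<noteq> 0"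
    using assms by simp_all
  have "\<bar>momentum u + momentum v\<bar> < real m" using s n_le_m by linarith
  then have "cis (2 * pi * (momentum u + momentum v) * of_int (-1) / real m) \<noteq> 1"
    using s by (intro cis_momentum_neq_1)
  then show ?thesis by (simp add: wave_def cis_mult algebra_simps add_divide_distrib diff_divide_distrib)
qed

abbreviation (input) box :: "int set" where "box \<equiv> {0..<int m}"

text \<open>The product of the two waves is an \<open>m\<close>-th root of unity whose powers sum to
  0 unless the momenta are opposite. For opposite momenta the sum is \<open>m\<close>, and the
  prefactor \<open>(z' + 1) / (z' - 1)\<close> is a cotangent.\<close>

lemma sgn_pair_sum_wave:
  assumes "u < n" "v < n" "2 * u + 1 \<noteq> n" "2 * v + 1 \<noteq> n"
  shows "sgn_pair_sum box (\<lambda>d. wave u (- d)) (\<lambda>d. wave v (- d))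
    = (if u + v + 1 = n then of_nat m * \<i> * complex_of_real (cot (pi * momentum v / m)) else 0)"
proof -
  let ?z = "wave u (-1)" and ?z' = "wave v (-1)"
  have eq: "sgn_pair_sum box (\<lambda>d. wave u (- d)) (\<lambda>d. wave v (- d))
      = sgn_pair_sum box (\<lambda>d. ?z ^ nat d) (\<lambda>d. ?z' ^ nat d)"
    unfolding sgn_pair_sum_def sum_int_lessThan by (simp add: wave_neg_eq_power)
  \<comment> \<open>The first factor vanishes for even \<open>n\<close> by antiperiodicity, the
    second for odd \<open>n\<close> because the momentum of \<open>u\<close> is nonzero.\<close>
  have "(1 + ?z' ^ m) * (\<Sum>k<m. ?z ^ k) = 0"
  proof (cases "even n")
    case True
    then show ?thesis by (simp add: wave_neg_power_m)
  next
    case False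
    then have "(\<Sum>k<m. ?z ^ k) = 0"
      using assms by (intro sum_root_of_unity) (simp_all add: wave_neg_power_m wave_neg_neq_1)
    then show ?thesis by simp
  qed
  then have pair: "sgn_pair_sum box (\<lambda>d. wave u (- d)) (\<lambda>d. wave v (- d)) = (?z' + 1) / (?z' - 1) * (\<Sum>k<m. (?z * ?z') ^ k)"
    unfolding eq using assms by (intro sgn_pair_sum_geometric wave_neg_neq_1)
  show ?thesis
  proof (cases "u + v + 1 = n")
    case True
    then have "momentum u + momentum v = 0" by (auto simp: momentum_def field_simps)
    then have "momentum u = - momentum v" by simp
    then have zz: "?z * ?z' = 1" by (simp add: wave_def cis_mult)
    define \<theta> where "\<theta> = pi * momentum v / m"
    have z': "?z' = cis (- \<theta>) * cis (- \<theta>)" 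
    proof -
      have "2 * pi * momentum v * of_int (-1) / real m = - \<theta> + - \<theta>" by (simp add: \<theta>_def)
      then show ?thesis by (simp only: wave_def cis_mult)
    qed
    have one: "1 = cis (- \<theta>) * cis \<theta>" by (simp add: cis_mult)
    have "?z' + 1 = cis (- \<theta>) * (2 * cos \<theta>)" unfolding z'
      by (subst one) (simp add: complex_eq_iff algebra_simps)
    moreover have "?z' - 1 = cis (- \<theta>) * (- 2 * \<i> * sin \<theta>)" unfolding z'
      by (subst one) (simp add: complex_eq_iff algebra_simps)
    ultimately have "(?z' + 1) / (?z' - 1) = (2 * cos \<theta>) / (- 2 * \<i> * sin \<theta>)"
      by simp
    also have "\<dots> = \<i> * cot \<theta>" 
      \<comment> \<open>If the sine is 0, both sides are 0 by the convention for division by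
        zero.\<close>
      by (cases "sin \<theta> = 0") (simp_all add: cot_def field_simps)
    finally show ?thesis using True unfolding pair zz by (simp add: \<theta>_def)
  next
    case False
    have "(\<Sum>k<m. (?z * ?z') ^ k) = 0"
      using assms False by (intro sum_root_of_unity wave_pair_neq_1)
        (simp_all add: power_mult_distrib wave_neg_power_m flip: power_add)
    then show ?thesis using False unfolding pair by simp
  qed
qed

text \<open>A union of pairs \<open>i\<close>, \<open>n - 1 - i\<close> of opposite nonzero momenta;
  raising \<open>q\<close> peels off the outermost pair. The excluded middle index has momentum
  0.\<close>

definition inner_indices :: "nat \<Rightarrow> nat set" where
  "inner_indices q = {i. q \<le> i \<and> i + q < n \<and> 2 * i + 1 \<noteq> n}"

lemma finite_inner_indices [simp]: "finite (inner_indices q)"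
  by (rule finite_subset[of _ "{..<n}"]) (auto simp: inner_indices_def)

lemma inner_indices_step:
  assumes "q < n div 2"
  shows "inner_indices q = insert q (insert (n - 1 - q) (inner_indices (Suc q)))"
  using assms by (auto simp: inner_indices_def)

text \<open>Expansion along the smallest index \<open>q\<close> leaves only its partner
  \<open>n - 1 - q\<close>. The partner is the largest index, preceded by an even number of others,
  so its sign is positive and each pair contributes one cotangent factor. The induction starts from
  the empty set and moves outwards.\<close>

lemma sgn_prod_sum_inner_indices:
  assumes "q \<le> n div 2"
  shows "even (card (inner_indices q)) \<and> sgn_prod_sum box (\<lambda>i d. wave i (- d)) (inner_indices q)
    = (\<Prod>h=1..n div 2 - q. of_nat m * \<i> * complex_of_real (cot (pi * (real h - (if even n then 1 / 2 else 0)) / m)))"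
  using assms
proof (induction q rule: inc_induct)
  case base
  have "inner_indices (n div 2) = {}" by (auto simp: inner_indices_def)
  then show ?case by (simp add: sgn_prod_sum_def)
next
  case (step q)
  let ?W = "\<lambda>i d. wave i (- d)" and ?b = "n - 1 - q" and ?I = "inner_indices (Suc q)"
  let ?B = "insert ?b ?I"
  have q: "q < n div 2" using step by simp
  have prod_Suc: "(\<Prod>h=1..Suc k. f h) = f (Suc k) * (\<Prod>h=1..k. f h)" for f :: "nat \<Rightarrow> complex" and k
    by (simp add: mult.commute)
  have Sq: "n div 2 - q = Suc (n div 2 - Suc q)" using q by simp
  have notin: "?b \<notin> ?I" "q \<notin> ?B" using q by (auto simp: inner_indices_def)
  have odd: "odd (card ?B)" using step.IH notin by simp
  have "{i \<in> ?B. i < ?b} = ?I" using q by (auto simp: inner_indices_def)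
  then have rank: "rank_sign ?B ?b = 1" using step.IH by (simp add: rank_sign_def)
  have diff: "?B - {?b} = ?I" using notin by auto
  have pair: "sgn_pair_sum box (?W q) (?W j) = (if j = ?b then of_nat m * \<i> * complex_of_real (cot (pi * momentum j / m)) else 0)"
    if "j \<in> ?B" for j
    using that q by (subst sgn_pair_sum_wave) (auto simp: inner_indices_def)
  have "sgn_prod_sum box ?W (inner_indices q)
     = (\<Sum>j\<in>?B. of_int (rank_sign ?B j) * sgn_pair_sum box (?W q) (?W j) * sgn_prod_sum box ?W (?B - {j}))"
    unfolding inner_indices_step[OF q]
  proof (rule sgn_prod_sum_even)
    show "q < i" if "i \<in> ?B" for i using that q by (auto simp: inner_indices_def)
  qed (use odd in auto)
  also have "\<dots> = (\<Sum>j\<in>?B. if j = ?b then of_nat m * \<i> * complex_of_real (cot (pi * momentum ?b / m)) * sgn_prod_sum box ?W ?I else 0)"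
  proof (rule sum.cong [OF refl])
    fix j assume "j \<in> ?B"
    then show "of_int (rank_sign ?B j) * sgn_pair_sum box (?W q) (?W j) * sgn_prod_sum box ?W (?B - {j})
      = (if j = ?b then of_nat m * \<i> * complex_of_real (cot (pi * momentum ?b / m)) * sgn_prod_sum box ?W ?I else 0)"
      by (cases "j = ?b") (simp_all only: pair rank diff, simp_all)
  qed
  also have "\<dots> = of_nat m * \<i> * complex_of_real (cot (pi * momentum ?b / m)) * sgn_prod_sum box ?W ?I"
    by simp
  also have "momentum ?b = real (n div 2 - q) - (if even n then 1 / 2 else 0)"
  proof (cases "even n")
    case True
    then obtain p where "n = 2 * p" by blast
    then show ?thesis unfolding momentum_def using q by (simp add: of_nat_diff field_simps)
  next
    case False
    then obtain p where "n = 2 * p + 1" using oddE by blast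
    then show ?thesis unfolding momentum_def using q by (simp add: of_nat_diff field_simps)
  qed
  finally have "sgn_prod_sum box ?W (inner_indices q) = (\<Prod>h=1..Suc (n div 2 - Suc q). of_nat m * \<i> * complex_of_real (cot (pi * (real h - (if even n then 1 / 2 else 0)) / m)))"
    by (simp only: Sq step.IH[THEN conjunct2] prod_Suc)
  moreover have "even (card (inner_indices q))"
    unfolding inner_indices_step[OF q] using odd notin by simp
  ultimately show ?case using q by (simp add: Suc_diff_Suc)
qed

text \<open>For odd \<open>n\<close> the zero momentum has no partner. The odd expansion singles it
  out: the plain sum of a wave is \<open>m\<close> for zero momentum and 0 for the others, and the
  middle position gives the sign \<open>(-1) ^ (n div 2)\<close>.\<close>

lemma sgn_prod_sum_wave:
  "sgn_prod_sum box (\<lambda>i d. wave i (- d)) {..<n} = (if even n then 1 else (-1) ^ (n div 2) * of_nat m)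
    * (\<Prod>h=1..n div 2. of_nat m * \<i> * complex_of_real (cot (pi * (real h - (if even n then 1 / 2 else 0)) / m)))"
proof (cases "even n")
  case True
  then have "inner_indices 0 = {..<n}" by (auto simp: inner_indices_def)
  then show ?thesis using sgn_prod_sum_inner_indices[of 0] True by simp
next
  case False
  let ?W = "\<lambda>i d. wave i (- d)"
  obtain p where p: "n = 2 * p + 1" using False oddE by blast
  have sum_wave: "(\<Sum>d\<in>box. wave j (- d)) = (if j = p then of_nat m else 0)" if "j < n" for j
  proof -
    have "(\<Sum>d\<in>box. wave j (- d)) = (\<Sum>k<m. wave j (-1) ^ k)"
      unfolding sum_int_lessThan wave_neg_eq_power ..
    also have "\<dots> = (if j = p then of_nat m else 0)"
    proof (cases "j = p")
      case True
      then have "momentum j = 0" unfolding momentum_def using p by simp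
      then show ?thesis using True by (simp add: wave_def)
    next
      case False
      then have "2 * j + 1 \<noteq> n" using p by linarith
      then show ?thesis using that False \<open>odd n\<close>
        by (simp add: sum_root_of_unity wave_neg_power_m wave_neg_neq_1)
    qed
    finally show ?thesis .
  qed
  have "sgn_prod_sum box ?W {..<n} = (\<Sum>j<n. of_int (rank_sign {..<n} j) * (\<Sum>d\<in>box. wave j (- d)) * sgn_prod_sum box ?W ({..<n} - {j}))"
    using False by (intro sgn_prod_sum_odd[where M = "int m"]) auto
  also have "\<dots> = (\<Sum>j<n. if j = p then of_int (rank_sign {..<n} p) * of_nat m * sgn_prod_sum box ?W ({..<n} - {p}) else 0)"
    by (intro sum.cong refl) (simp add: sum_wave)
  also have "\<dots> = of_int (rank_sign {..<n} p) * of_nat m * sgn_prod_sum box ?W ({..<n} - {p})"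
    using p by (subst sum.delta) auto
  also have "{..<n} - {p} = inner_indices 0"
    unfolding inner_indices_def using p by auto
  also have "rank_sign {..<n} p = (-1) ^ p"
  proof -
    have "{i \<in> {..<n}. i < p} = {..<p}" using p by auto
    then show ?thesis by (simp add: rank_sign_def)
  qed
  also have "p = n div 2" using p by simp
  finally show ?thesis using sgn_prod_sum_inner_indices[of 0] False by simp
qed

end

section \<open>Signed walks and reflection\<close>

lemma prod_pairs_constant: "(\<Prod>i<n. \<Prod>j\<in>{i<..<n}. c) = (c::'a::comm_monoid_mult) ^ (n choose 2)"
proof (induction n)
  case (Suc n)
  then show ?case unfolding prod_pairs_Suc by (simp add: numeral_2_eq_2 power_add mult.commute)
qed (simp add: numeral_2_eq_2)

lemma prod_pairs_mult: "(\<Prod>i<n. \<Prod>j\<in>{i<..<n}. c i * c j) = (\<Prod>i<n. (c i :: 'a::comm_monoid_mult) ^ (n - 1))"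
proof (induction n)
  case (Suc n)
  have "(\<Prod>i<n. \<Prod>j\<in>{i<..<n}. c i * c j) * (\<Prod>i<n. c i) = (\<Prod>i<n. c i ^ n)"
    unfolding Suc.IH prod.distrib[symmetric]
    by (intro prod.cong refl) (metis Suc_diff_1 Suc_pred lessThan_iff less_nat_zero_code neq0_conv power_Suc2)
  then show ?case unfolding prod_pairs_Suc by (simp add: prod.distrib mult.assoc[symmetric])
qed simp

context circle
begin

definition vand :: "(nat \<Rightarrow> int) \<Rightarrow> real" where
  "vand x = (\<Prod>i<n. \<Prod>j\<in>{i<..<n}. sin (pi * of_int (x i - x j) / real m))"

text \<open>Each sine is a difference of two points \<open>z j - z i\<close> on the unit circle
  times half phases \<open>c i * c j\<close>. Every index lies in \<open>n - 1\<close> pairs, and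
  the collected phases \<open>c i ^ (n - 1)\<close> shift the Vandermonde exponents to the centred
  momenta. The result is the Slater determinant of the \<open>n\<close> waves.\<close>

lemma vand_slater:
  "(- 2 * \<i>) ^ (n choose 2) * complex_of_real (vand x)
    = (\<Sum>\<sigma> | \<sigma> permutes {..<n}. of_int (sign \<sigma>) * (\<Prod>i<n. wave (\<sigma> i) (x i)))"
proof -
  define c where "c = (\<lambda>i. cis (- (pi * of_int (x i) / m)))"
  define z where "z = (\<lambda>i. cis (2 * pi * of_int (x i) / m))"
  have c: "c i * c j * (z j - z i) = (- 2 * \<i>) * complex_of_real (sin (pi * of_int (x i - x j) / m))" for i j
  proof -
    define \<alpha> where "\<alpha> = pi * of_int (x i) / m"
    define \<beta> where "\<beta> = pi * of_int (x j) / m"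
    have z: "z i = cis (\<alpha> + \<alpha>)" "z j = cis (\<beta> + \<beta>)" and c: "c i = cis (- \<alpha>)" "c j = cis (- \<beta>)"
      by (simp_all add: z_def c_def \<alpha>_def \<beta>_def mult.assoc)
    have "pi * of_int (x i - x j) / m = \<alpha> - \<beta>"
      by (simp add: \<alpha>_def \<beta>_def diff_divide_distrib algebra_simps)
    moreover have "c i * c j * (z j - z i) = cis (- \<alpha>) * cis (- \<beta>) * cis (\<beta> + \<beta>) - cis (- \<alpha>) * cis (- \<beta>) * cis (\<alpha> + \<alpha>)"
      unfolding z c by (simp add: algebra_simps)
    moreover have "\<dots> = cis (- (\<alpha> - \<beta>)) - cis (\<alpha> - \<beta>)"
      by (simp add: cis_mult)
    moreover have "\<dots> = (- 2 * \<i>) * complex_of_real (sin (\<alpha> - \<beta>))"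
      by (simp only: complex_eq_iff) (simp add: cos_diff sin_diff)
    ultimately show ?thesis by simp
  qed
  have w: "wave u (x i) = c i ^ (n - 1) * z i ^ u" if "i < n" for u i
  proof -
    have "2 * pi * momentum u * of_int (x i) / m = real (n - 1) * - (pi * of_int (x i) / m) + real u * (2 * pi * of_int (x i) / m)"
      using that m_pos by (simp add: momentum_def of_nat_diff field_simps)
    then show ?thesis by (simp only: wave_def c_def z_def DeMoivre cis_mult)
  qed
  have "\<kappa> ^ (n choose 2) * complex_of_real (vand x) = (\<Prod>i<n. \<Prod>j\<in>{i<..<n}. \<kappa> * complex_of_real (sin (pi * of_int (x i - x j) / m)))" for \<kappa>
    unfolding prod.distrib prod_pairs_constant by (simp add: vand_def)
  then have "(- 2 * \<i>) ^ (n choose 2) * complex_of_real (vand x) = (\<Prod>i<n. \<Prod>j\<in>{i<..<n}. c i * c j * (z j - z i))"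
    by (simp only: c)
  also have "\<dots> = (\<Prod>i<n. c i ^ (n - 1)) * det (vandermonde_mat n z)"
    unfolding prod.distrib prod_pairs_mult[unfolded prod.distrib] det_vandermonde_mat ..
  also have "\<dots> = (\<Sum>\<sigma> | \<sigma> permutes {..<n}. of_int (sign \<sigma>) * ((\<Prod>i<n. c i ^ (n - 1)) * (\<Prod>i<n. z i ^ \<sigma> i)))"
    unfolding det_def'[OF vandermonde_mat_carrier] sum_distrib_left lessThan_atLeast0
  proof (intro sum.cong refl)
    fix \<sigma> assume "\<sigma> \<in> {p. p permutes {0..<n}}"
    then have "\<sigma> i < n" if "i < n" for i using permutes_in_image[of \<sigma> "{0..<n}" i] that by simp
    then have "(\<Prod>i=0..<n. vandermonde_mat n z $$ (i, \<sigma> i)) = (\<Prod>i=0..<n. z i ^ \<sigma> i)"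
      by (intro prod.cong refl) (simp add: vandermonde_mat_def)
    then show "(\<Prod>i=0..<n. c i ^ (n - 1)) * (signof \<sigma> * (\<Prod>i=0..<n. vandermonde_mat n z $$ (i, \<sigma> i)))
        = of_int (sign \<sigma>) * ((\<Prod>i=0..<n. c i ^ (n - 1)) * (\<Prod>i=0..<n. z i ^ \<sigma> i))"
      by simp
  qed
  also have "\<dots> = (\<Sum>\<sigma> | \<sigma> permutes {..<n}. of_int (sign \<sigma>) * (\<Prod>i<n. wave (\<sigma> i) (x i)))"
    by (intro sum.cong refl) (simp add: w flip: prod.distrib)
  finally show ?thesis .
qed

lemma vand_permute:
  assumes "\<tau> permutes {..<n}"
  shows "vand (x \<circ> \<tau>) = of_int (sign \<tau>) * vand x"
proof -
  have "(- 2 * \<i>) ^ (n choose 2) * complex_of_real (vand (x \<circ> \<tau>))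
      = (\<Sum>\<sigma> | \<sigma> permutes {..<n}. of_int (sign (\<sigma> \<circ> \<tau>)) * (\<Prod>i<n. wave ((\<sigma> \<circ> \<tau>) i) ((x \<circ> \<tau>) i)))"
    unfolding vand_slater by (rule sum_permutations_compose_right[OF assms])
  also have "\<dots> = (\<Sum>\<sigma> | \<sigma> permutes {..<n}. of_int (sign \<tau>) * (of_int (sign \<sigma>) * (\<Prod>i<n. wave (\<sigma> i) (x i))))"
  proof (intro sum.cong refl)
    fix \<sigma> assume "\<sigma> \<in> {\<sigma>. \<sigma> permutes {..<n}}"
    then have "sign (\<sigma> \<circ> \<tau>) = sign \<sigma> * sign \<tau>"
      using assms by (intro sign_compose) (auto intro: permutes_imp_permutation)
    moreover have "(\<Prod>i<n. wave ((\<sigma> \<circ> \<tau>) i) ((x \<circ> \<tau>) i)) = (\<Prod>i<n. wave (\<sigma> i) (x i))"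
      using prod.permute[OF assms, of "\<lambda>i. wave (\<sigma> i) (x i)"] by (simp add: o_def)
    ultimately show "of_int (sign (\<sigma> \<circ> \<tau>)) * (\<Prod>i<n. wave ((\<sigma> \<circ> \<tau>) i) ((x \<circ> \<tau>) i))
       = of_int (sign \<tau>) * (of_int (sign \<sigma>) * (\<Prod>i<n. wave (\<sigma> i) (x i)))" by simp
  qed
  also have "\<dots> = (- 2 * \<i>) ^ (n choose 2) * complex_of_real (of_int (sign \<tau>) * vand x)"
    unfolding sum_distrib_left[symmetric] vand_slater[symmetric] by simp
  finally show ?thesis
    by (simp only: mult_cancel_left of_real_eq_iff) simp
qed

text \<open>The sign a wave acquires over \<open>q\<close> turns. Only the parity of
  \<open>q\<close> matters, so the absolute value loses nothing.\<close>

definition twist :: "int \<Rightarrow> int" where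
  "twist q = (-1) ^ ((n + 1) * nat \<bar>q\<bar>)"

lemma twist_square [simp]: "twist q * twist q = 1"
  by (simp add: twist_def flip: power_add mult_2)

lemma twist_minus [simp]: "twist (- q) = twist q"
  by (simp add: twist_def)

lemma wave_period: "wave u (int m * q) = of_int (twist q)"
proof -
  have neg: "wave u (int m * - int k) = of_int (twist (int k))" for k
  proof -
    have "wave u (int m * - int k) = wave u (-1) ^ (m * k)"
      by (simp add: wave_neg_eq_power[symmetric])
    then show ?thesis 
      by (simp only: power_mult wave_neg_power_m twist_def of_int_power nat_int abs_of_nat of_int_minus of_int_1)
  qed
  have "wave u (int m * int k) = of_int (twist (int k))" for k
  proof -
    have "wave u (int m * int k) * wave u (int m * - int k) = 1"
      by (simp flip: wave_add)
    then have "wave u (int m * int k) * of_int (twist (int k)) * of_int (twist (int k)) = of_int (twist (int k))"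
      unfolding neg by simp
    then show ?thesis by (simp only: mult.assoc of_int_mult[symmetric] twist_square) simp
  qed
  then show ?thesis using neg by (cases q rule: int_cases2) auto
qed

text \<open>Each term of the Slater determinant has one wave per coordinate, and the twist is the
  same for all momenta, so it factors out.\<close>

lemma vand_period: "vand (\<lambda>i. x i + int m * q i) = (\<Prod>i<n. of_int (twist (q i))) * vand x"
proof -
  have "(- 2 * \<i>) ^ (n choose 2) * complex_of_real (vand (\<lambda>i. x i + int m * q i))
    = (- 2 * \<i>) ^ (n choose 2) * complex_of_real ((\<Prod>i<n. of_int (twist (q i))) * vand x)"
    unfolding vand_slater of_real_mult mult.left_commute[of "_ ^ _"]
    by (simp add: wave_add wave_period prod.distrib sum_distrib_left algebra_simps)
  then show ?thesis by (simp only: mult_cancel_left of_real_eq_iff) simp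
qed

text \<open>Sums the sign of \<open>vand\<close> over the end points of all free walks, collisions
  included; \<open>E\<close> is the set of coordinates that move in the first step.\<close>

primrec signed_walks :: "nat \<Rightarrow> (nat \<Rightarrow> int) \<Rightarrow> real" where
  "signed_walks 0 x = sgn (vand x)"
| "signed_walks (Suc k) x = (\<Sum>E\<in>Pow {..<n}. signed_walks k (\<lambda>i. x i + of_bool (i \<in> E)))"

lemma signed_walks_permute:
  assumes "\<tau> permutes {..<n}"
  shows "signed_walks k (x \<circ> \<tau>) = of_int (sign \<tau>) * signed_walks k x"
proof (induction k arbitrary: x)
  case 0
  show ?case by (simp only: signed_walks.simps vand_permute[OF assms]) (simp add: sgn_mult sign_def)
next
  case (Suc k)
  have im: "\<tau> i \<in> {..<n} \<longleftrightarrow> i \<in> {..<n}" for i using permutes_in_image[OF assms] .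
  have "signed_walks (Suc k) (x \<circ> \<tau>) = (\<Sum>E\<in>Pow {..<n}. signed_walks k ((\<lambda>i. x i + of_bool (i \<in> E)) \<circ> \<tau>))"
    unfolding signed_walks.simps
  proof (rule sum.reindex_bij_witness[of _ "\<lambda>E. \<tau> -` E" "\<lambda>E. \<tau> ` E"])
    fix E assume "E \<in> Pow {..<n}"
    then show "\<tau> -` \<tau> ` E = E" "\<tau> ` E \<in> Pow {..<n}" "\<tau> ` \<tau> -` E = E" "\<tau> -` E \<in> Pow {..<n}"
      using im permutes_inj[OF assms] permutes_surj[OF assms]
      by (auto simp: inj_vimage_image_eq)
    show "signed_walks k ((\<lambda>i. x i + of_bool (i \<in> \<tau> ` E)) \<circ> \<tau>)
      = signed_walks k (\<lambda>i. (x \<circ> \<tau>) i + of_bool (i \<in> E))"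
      using permutes_inj[OF assms] by (simp add: o_def inj_image_mem_iff)
  qed
  then show ?case by (simp add: Suc.IH sum_distrib_left)
qed

lemma signed_walks_period: "signed_walks k (\<lambda>i. x i + int m * q i) = (\<Prod>i<n. of_int (twist (q i))) * signed_walks k x"
proof (induction k arbitrary: x)
  case 0
  define t :: real where "t = (\<Prod>i<n. of_int (twist (q i)))"
  \<comment> \<open>A factor of 1 or -1 is its own sign, so it passes through
    \<open>sgn\<close>.\<close>
  have "t * t = 1"
    unfolding t_def prod.distrib[symmetric] by (simp flip: of_int_mult)
  then have "sgn t = t" by (auto simp: square_eq_1_iff)
  then show ?case unfolding signed_walks.simps vand_period t_def[symmetric] by (simp add: sgn_mult)
next
  case (Suc k)
  have "signed_walks (Suc k) (\<lambda>i. x i + int m * q i) = (\<Sum>E\<in>Pow {..<n}. signed_walks k (\<lambda>i. (x i + of_bool (i \<in> E)) + int m * q i))"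
    by (simp add: algebra_simps)
  then show ?case by (simp add: Suc.IH sum_distrib_left)
qed

section \<open>Collisions and the reflection argument\<close>

lemma vand_eq_0_iff: "vand x = 0 \<longleftrightarrow> (\<exists>i<n. \<exists>j<n. i \<noteq> j \<and> int m dvd x i - x j)"
proof -
  have sin: "sin (pi * of_int d / real m) = 0 \<longleftrightarrow> int m dvd d" for d :: int
  proof -
    have "sin (pi * of_int d / real m) = 0 \<longleftrightarrow> (\<exists>k::int. pi * real_of_int d = pi * (of_int k * real m))"
      unfolding sin_zero_iff_int2 using m_pos by (simp add: field_simps)
    also have "\<dots> \<longleftrightarrow> (\<exists>k. d = k * int m)"
      by (simp only: mult_left_cancel[OF pi_neq_zero]) (metis of_int_eq_iff of_int_mult of_int_of_nat_eq)
    finally show ?thesis by (auto simp: dvd_def mult.commute)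
  qed
  have "vand x = 0 \<longleftrightarrow> (\<exists>i<n. \<exists>j\<in>{i<..<n}. int m dvd x i - x j)"
    by (simp add: vand_def sin Bex_def del: of_int_diff)
  also have "\<dots> \<longleftrightarrow> (\<exists>i<n. \<exists>j<n. i \<noteq> j \<and> int m dvd x i - x j)"
  proof
    assume "\<exists>i<n. \<exists>j\<in>{i<..<n}. int m dvd x i - x j"
    then show "\<exists>i<n. \<exists>j<n. i \<noteq> j \<and> int m dvd x i - x j" by fastforce
  next
    assume "\<exists>i<n. \<exists>j<n. i \<noteq> j \<and> int m dvd x i - x j"
    then obtain i j where ij: "i < n" "j < n" "i \<noteq> j" "int m dvd x i - x j" by blast
    then have "int m dvd x j - x i" by (simp add: dvd_diff_commute)
    with ij show "\<exists>i<n. \<exists>j\<in>{i<..<n}. int m dvd x i - x j"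
      by (metis greaterThanLessThan_iff linorder_neqE_nat)
  qed
  finally show ?thesis .
qed

text \<open>Reflection principle: exchanging two colliding coordinates only translates the point by
  a period, so that an antisymmetric function with matching periods must vanish there.\<close>

lemma signed_walks_eq_0:
  assumes "vand x = 0"
  shows "signed_walks k x = 0"
proof -
  obtain i j q where ij: "i < n" "j < n" "i \<noteq> j" and q: "x i - x j = int m * q"
    using assms unfolding vand_eq_0_iff by (auto elim!: dvdE)
  \<comment> \<open>Exchanging the colliding coordinates moves one by \<open>-q\<close> turns and
    the other by \<open>q\<close>. The two twists multiply to 1, so the exchange reverses the sign
    of \<open>signed_walks k x\<close> and also preserves it.\<close>
  define r where "r = (\<lambda>l. if l = i then - q else if l = j then q else 0)"
  let ?\<tau> = "Transposition.transpose i j"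
  have \<tau>: "?\<tau> permutes {..<n}" using ij by (intro permutes_swap_id) auto
  have "x \<circ> ?\<tau> = (\<lambda>l. x l + int m * r l)"
    using q ij by (auto simp: fun_eq_iff r_def Transposition.transpose_def algebra_simps)
  then have "- signed_walks k x = (\<Prod>l<n. of_int (twist (r l))) * signed_walks k x"
    using signed_walks_permute[OF \<tau>, of k x] ij by (simp add: sign_swap_id signed_walks_period)
  also have "(\<Prod>l<n. of_int (twist (r l))) = (1::real)"
  proof -
    have "twist (r l) = (if l = i then twist q else 1) * (if l = j then twist q else 1)" for l
      using ij by (simp add: r_def twist_def)
    then have "(\<Prod>l<n. twist (r l)) = twist q * twist q"
      using ij by (simp only: prod.distrib prod.delta finite_lessThan) simp
    then show ?thesis by (simp flip: of_int_prod)
  qed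
  finally show ?thesis by simp
qed

text \<open>A step changes an integer difference by at most 1, so the difference may reach a
  multiple of \<open>m\<close> but cannot jump across one. No sine factor changes sign
  strictly.\<close>

lemma vand_step: "vand x * vand (\<lambda>i. x i + of_bool (i \<in> E)) \<ge> 0"
proof -
  have sin: "0 \<le> sin (pi * of_int d / m) * sin (pi * of_int (d + e) / m)" if e: "\<bar>e\<bar> \<le> 1" for d e :: int
  proof (cases "int m dvd d")
    case True
    then obtain k where "d = int m * k" by (auto elim: dvdE)
    then show ?thesis using m_pos by simp
  next
    case False
    define k r where "k = d div int m" and "r = d mod int m"
    have d: "d = int m * k + r" by (simp add: k_def r_def)
    have "0 \<le> r" "r < int m" using m_pos by (simp_all add: r_def)
    moreover have "r \<noteq> 0" using False by (simp add: r_def dvd_eq_mod_eq_0)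
    \<comment> \<open>Before and after the step the difference stays in one half turn
      \<open>k\<close>; the common factor \<open>cos (pi * k)\<close> enters squared.\<close>
    ultimately have r: "0 \<le> r" "r \<le> int m" "0 \<le> r + e" "r + e \<le> int m" using e by auto
    have nonneg: "0 \<le> sin (pi * of_int s / m)" if "0 \<le> s" "s \<le> int m" for s :: int
    proof (rule sin_ge_zero)
      show "0 \<le> pi * of_int s / m" using that by simp
      have "real_of_int s \<le> real m" using that by linarith
      then show "pi * of_int s / m \<le> pi" using m_pos by (simp add: field_simps)
    qed
    have shift: "sin (pi * of_int (int m * k + s) / m) = cos (pi * of_int k) * sin (pi * of_int s / m)" for s :: int
    proof -
      have "pi * of_int (int m * k + s) / m = pi * of_int k + pi * of_int s / m"
        using m_pos by (simp add: field_simps)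
      then show ?thesis by (simp only: sin_add sin_npi_int)
    qed
    have "sin (pi * of_int d / m) * sin (pi * of_int (d + e) / m)
      = (cos (pi * of_int k))\<^sup>2 * (sin (pi * of_int r / m) * sin (pi * of_int (r + e) / m))"
      unfolding d add.assoc shift by (simp add: power2_eq_square)
    moreover have "0 \<le> sin (pi * of_int r / m) * sin (pi * of_int (r + e) / m)"
      using r by (intro mult_nonneg_nonneg nonneg)
    ultimately show ?thesis by (metis mult_nonneg_nonneg zero_le_power2)
  qed
  have "(\<Prod>i<n. \<Prod>j\<in>{i<..<n}. sin (pi * of_int (x i - x j) / m)
      * sin (pi * of_int ((x i + of_bool (i \<in> E)) - (x j + of_bool (j \<in> E))) / m)) \<ge> 0"
  proof (intro prod_nonneg)
    fix i j
    have "(x i + of_bool (i \<in> E)) - (x j + of_bool (j \<in> E)) = (x i - x j) + (of_bool (i \<in> E) - of_bool (j \<in> E))"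
      by simp
    then show "0 \<le> sin (pi * of_int (x i - x j) / m)
      * sin (pi * of_int ((x i + of_bool (i \<in> E)) - (x j + of_bool (j \<in> E))) / m)"
      by (simp only:) (rule sin, simp)
  qed
  then show ?thesis by (simp only: vand_def prod.distrib)
qed

text \<open>Lets the sign of the starting point be carried along the walk: if the step collides, the
  remaining signed count is 0 by reflection, and otherwise the sign of \<open>vand\<close> is
  unchanged.\<close>

lemma sgn_vand_step:
  assumes "vand x \<noteq> 0"
  shows "sgn (vand (\<lambda>i. x i + of_bool (i \<in> E))) * signed_walks k (\<lambda>i. x i + of_bool (i \<in> E))
    = sgn (vand x) * signed_walks k (\<lambda>i. x i + of_bool (i \<in> E))"
proof (cases "vand (\<lambda>i. x i + of_bool (i \<in> E)) = 0")
  case True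
  then show ?thesis by (simp add: signed_walks_eq_0)
next
  case False
  then have "sgn (vand (\<lambda>i. x i + of_bool (i \<in> E))) = sgn (vand x)"
    using vand_step[of x E] assms by (auto simp: sgn_if zero_le_mult_iff)
  then show ?thesis by simp
qed

end

section \<open>Counting collision-free walks\<close>

lemma circle_walksD:
  assumes "p \<in> circle_walks n m \<eta> k"
  shows "p \<in> {0..k} \<rightarrow>\<^sub>E points n"
    and "\<And>i h. i \<in> {1..k} \<Longrightarrow> h \<in> {1..n} \<Longrightarrow> p i h - p (i - 1) h \<in> {-1/2, 1/2}"
    and "\<And>h. h \<in> {1..n} \<Longrightarrow> p 0 h = \<eta> h"
    and "\<And>i h t. i \<in> {0..k} \<Longrightarrow> h \<in> {1..n} \<Longrightarrow> t \<in> {1..n} \<Longrightarrow> h \<noteq> t \<Longrightarrow> \<not> [p i h = p i t] (rmod real m)"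
  using assms by (auto simp: circle_walks_def diagonal_walks_def)

lemma circle_walksI:
  assumes "p \<in> {0..k} \<rightarrow>\<^sub>E points n"
    and "\<And>i h. i \<in> {1..k} \<Longrightarrow> h \<in> {1..n} \<Longrightarrow> p i h - p (i - 1) h \<in> {-1/2, 1/2}"
    and "\<And>h. h \<in> {1..n} \<Longrightarrow> p 0 h = \<eta> h"
    and "\<And>i h t. i \<in> {0..k} \<Longrightarrow> h \<in> {1..n} \<Longrightarrow> t \<in> {1..n} \<Longrightarrow> h \<noteq> t \<Longrightarrow> \<not> [p i h = p i t] (rmod real m)"
  shows "p \<in> circle_walks n m \<eta> k"
  using assms by (auto simp: circle_walks_def diagonal_walks_def)

text \<open>\<open>E\<close> collects the coordinates that go up, counted from 0 as in
  \<open>signed_walks\<close>, whereas points are indexed from 1.\<close>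

definition diagonal_step :: "nat set \<Rightarrow> (nat \<Rightarrow> real) \<Rightarrow> nat \<Rightarrow> real" where
  "diagonal_step E \<eta> h = \<eta> h + (if h - 1 \<in> E then 1/2 else -1/2)"

lemma circle_walks_0:
  assumes "\<And>h t. h \<in> {1..n} \<Longrightarrow> t \<in> {1..n} \<Longrightarrow> h \<noteq> t \<Longrightarrow> \<not> [\<eta> h = \<eta> t] (rmod real m)"
  shows "circle_walks n m \<eta> 0 = {\<lambda>i\<in>{0}. restrict \<eta> {1..n}}"
proof
  show "circle_walks n m \<eta> 0 \<subseteq> {\<lambda>i\<in>{0}. restrict \<eta> {1..n}}"
  proof
    fix p assume p: "p \<in> circle_walks n m \<eta> 0"
    have "p = (\<lambda>i\<in>{0}. restrict \<eta> {1..n})"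
    proof (intro ext)
      fix i h
      show "p i h = (\<lambda>i\<in>{0}. restrict \<eta> {1..n}) i h"
        using circle_walksD(1,3)[OF p] PiE_mem[OF circle_walksD(1)[OF p], of 0]
        by (cases "i = 0"; cases "h \<in> {1..n}")
          (auto simp: points_def PiE_def extensional_def)
    qed
    then show "p \<in> {\<lambda>i\<in>{0}. restrict \<eta> {1..n}}" by simp
  qed
  show "{\<lambda>i\<in>{0}. restrict \<eta> {1..n}} \<subseteq> circle_walks n m \<eta> 0"
    using assms by (auto intro!: circle_walksI simp: points_def)
qed

text \<open>Decomposes a walk by its first step; the inverse reads \<open>E\<close> off the first
  two points and drops the starting point.\<close>

lemma bij_betw_circle_walks_Suc:
  assumes "\<And>h t. h \<in> {1..n} \<Longrightarrow> t \<in> {1..n} \<Longrightarrow> h \<noteq> t \<Longrightarrow> \<not> [\<eta> h = \<eta> t] (rmod real m)"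
  shows "bij_betw (\<lambda>(E, p) i. if i = 0 then restrict \<eta> {1..n} else p (i - 1))
    (SIGMA E : Pow {..<n}. circle_walks n m (diagonal_step E \<eta>) k) (circle_walks n m \<eta> (Suc k))"
proof (rule bij_betw_byWitness[where f' = "\<lambda>p. ({i. i < n \<and> p 1 (Suc i) - p 0 (Suc i) = 1/2}, \<lambda>i. p (Suc i))"])
  let ?f = "\<lambda>(E, p) i. if i = 0 then restrict \<eta> {1..n} else p (i - 1)"
  let ?g = "\<lambda>p. ({i. i < n \<and> p 1 (Suc i) - p 0 (Suc i) = 1/2}, \<lambda>i. p (Suc i))"
  let ?S = "SIGMA E : Pow {..<n}. circle_walks n m (diagonal_step E \<eta>) k"
  show "\<forall>a\<in>?S. ?g (?f a) = a"
  proof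
    fix a assume "a \<in> ?S"
    then obtain E p where a: "a = (E, p)" and E: "E \<subseteq> {..<n}" and p: "p \<in> circle_walks n m (diagonal_step E \<eta>) k"
      by auto
    have "p 0 (Suc i) = diagonal_step E \<eta> (Suc i)" if "i < n" for i
      using circle_walksD(3)[OF p, of "Suc i"] that by simp
    then have 1: "{i. i < n \<and> ?f (E, p) 1 (Suc i) - ?f (E, p) 0 (Suc i) = 1/2} = E"
      using E by (auto simp: diagonal_step_def split: if_splits)
    have 2: "(\<lambda>i. ?f (E, p) (Suc i)) = p" by simp
    show "?g (?f a) = a" by (simp only: a 1 2)
  qed
  show "\<forall>p\<in>circle_walks n m \<eta> (Suc k). ?f (?g p) = p"
  proof
    fix p assume p: "p \<in> circle_walks n m \<eta> (Suc k)"
    have "p 0 \<in> points n" using PiE_mem[OF circle_walksD(1)[OF p], of 0] by simp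
    then have "restrict \<eta> {1..n} = p 0"
      using circle_walksD(3)[OF p] by (auto simp: points_def PiE_def extensional_def fun_eq_iff)
    then show "?f (?g p) = p" by (auto simp: fun_eq_iff)
  qed
  show "?f ` ?S \<subseteq> circle_walks n m \<eta> (Suc k)"
  proof clarify
    fix E p assume E: "E \<subseteq> {..<n}" and p: "p \<in> circle_walks n m (diagonal_step E \<eta>) k"
    show "(\<lambda>i. if i = 0 then restrict \<eta> {1..n} else p (i - 1)) \<in> circle_walks n m \<eta> (Suc k)"
    proof (rule circle_walksI)
      have "p i = undefined" if "i > k" for i
        using circle_walksD(1)[OF p] that by (auto simp: PiE_def extensional_def)
      moreover have "p i \<in> points n" if "i \<le> k" for i
        using PiE_mem[OF circle_walksD(1)[OF p], of i] that by simp
      ultimately show "(\<lambda>i. if i = 0 then restrict \<eta> {1..n} else p (i - 1)) \<in> {0..Suc k} \<rightarrow>\<^sub>E points n"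
        by (auto simp: PiE_def extensional_def points_def)
    next
      fix i h assume i: "i \<in> {1..Suc k}" and h: "h \<in> {1..n}"
      show "(if i = 0 then restrict \<eta> {1..n} else p (i - 1)) h
          - (if i - 1 = 0 then restrict \<eta> {1..n} else p (i - 1 - 1)) h \<in> {- 1 / 2, 1 / 2}"
      proof (cases "i = 1")
        case True
        then show ?thesis using h circle_walksD(3)[OF p h] by (simp add: diagonal_step_def)
      next
        case False
        then obtain l where "i = Suc (Suc l)"
          using i by (metis One_nat_def Suc_pred atLeastAtMost_iff diff_is_0_eq' le_antisym not_gr_zero not_less_eq_eq)
        then show ?thesis using i h circle_walksD(2)[OF p, of "Suc l" h] by simp
      qed
    next
      fix i h t assume "i \<in> {0..Suc k}" and "h \<in> {1..n}" "t \<in> {1..n}" "h \<noteq> t"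
      then show "\<not> [(if i = 0 then restrict \<eta> {1..n} else p (i - 1)) h
          = (if i = 0 then restrict \<eta> {1..n} else p (i - 1)) t] (rmod real m)"
        using assms[of h t] circle_walksD(4)[OF p, of "i - 1" h t] by auto
    qed auto
  qed
  show "?g ` circle_walks n m \<eta> (Suc k) \<subseteq> ?S"
  proof (rule image_subsetI)
    fix p assume p: "p \<in> circle_walks n m \<eta> (Suc k)"
    define E where "E = {i. i < n \<and> p 1 (Suc i) - p 0 (Suc i) = 1 / 2}"
    have "(\<lambda>i. p (Suc i)) \<in> circle_walks n m (diagonal_step E \<eta>) k"
    proof (rule circle_walksI)
      show "(\<lambda>i. p (Suc i)) \<in> {0..k} \<rightarrow>\<^sub>E points n"
        using circle_walksD(1)[OF p] by (auto simp: PiE_def extensional_def Pi_def)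
    next
      fix i h assume "i \<in> {1..k}" and "h \<in> {1..n}"
      then show "p (Suc i) h - p (Suc (i - 1)) h \<in> {- 1 / 2, 1 / 2}"
        using circle_walksD(2)[OF p, of "Suc i" h] by simp
    next
      fix h assume h: "h \<in> {1..n}"
      have "p 1 h - p 0 h \<in> {- 1 / 2, 1 / 2}"
        using circle_walksD(2)[OF p, of 1 h] h by simp
      moreover have "h - 1 < n" "Suc (h - 1) = h" using h by auto
      then have "h - 1 \<in> E \<longleftrightarrow> p 1 h - p 0 h = 1 / 2"
        unfolding E_def by (simp only: mem_Collect_eq simp_thms)
      ultimately show "p (Suc 0) h = diagonal_step E \<eta> h"
        using circle_walksD(3)[OF p h] by (auto simp: diagonal_step_def)
    next
      fix i h t assume "i \<in> {0..k}" and "h \<in> {1..n}" "t \<in> {1..n}" "h \<noteq> t"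
      then show "\<not> [p (Suc i) h = p (Suc i) t] (rmod real m)"
        using circle_walksD(4)[OF p, of "Suc i" h t] by simp
    qed
    moreover have "E \<subseteq> {..<n}" by (auto simp: E_def)
    ultimately show "?g p \<in> ?S"
      unfolding E_def[symmetric] by simp
  qed
qed

context circle
begin

lemma rcong_iff_dvd: "[of_int a = of_int b] (rmod real m) \<longleftrightarrow> int m dvd a - b"
proof -
  have "[of_int a = of_int b] (rmod real m) \<longleftrightarrow> (\<exists>k. b = a + k * int m)"
  proof -
    have "real_of_int a + of_int k * real m = of_int (a + k * int m)" for k by simp
    then show ?thesis by (simp only: rcong_altdef of_int_eq_iff)
  qed
  also have "\<dots> \<longleftrightarrow> int m dvd b - a"
    by (auto simp: dvd_def algebra_simps)
  finally show ?thesis by (simp add: dvd_diff_commute)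
qed

lemma no_collision:
  assumes "\<And>h. h \<in> {1..n} \<Longrightarrow> \<eta> h = of_int (x (h - 1)) + c" and "vand x \<noteq> 0"
    and "h \<in> {1..n}" "t \<in> {1..n}" "h \<noteq> t"
  shows "\<not> [\<eta> h = \<eta> t] (rmod real m)"
proof -
  have "h - 1 < n" "t - 1 < n" "h - 1 \<noteq> t - 1" using assms(3-5) by auto
  then show ?thesis using assms(2) by (auto simp: assms(1)[OF assms(3)] assms(1)[OF assms(4)] rcong_iff_dvd vand_eq_0_iff)
qed

lemma circle_walks_collision:
  assumes "\<And>h. h \<in> {1..n} \<Longrightarrow> \<eta> h = of_int (x (h - 1)) + c" and "vand x = 0"
  shows "circle_walks n m \<eta> k = {}"
proof -
  obtain i j where ij: "i < n" "j < n" "i \<noteq> j" "int m dvd x i - x j"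
    using assms(2) unfolding vand_eq_0_iff by blast
  have "[\<eta> (Suc i) = \<eta> (Suc j)] (rmod real m)"
    using ij by (simp add: assms(1) rcong_iff_dvd)
  then have False if p: "p \<in> circle_walks n m \<eta> k" for p
    using circle_walksD(3)[OF p, of "Suc i"] circle_walksD(3)[OF p, of "Suc j"]
      circle_walksD(4)[OF p, of 0 "Suc i" "Suc j"] ij by simp
  then show ?thesis by blast
qed

text \<open>Induction over the first step. Recoding the steps \<open>-1/2\<close>,
  \<open>1/2\<close> as 0, 1 lowers the common offset \<open>c\<close> by \<open>1/2\<close> each
  time, so \<open>c\<close> has to vary. A colliding start gives no walks, matching the factor
  \<open>sgn 0 = 0\<close>.\<close>

lemma card_circle_walks:
  assumes "\<And>h. h \<in> {1..n} \<Longrightarrow> \<eta> h = of_int (x (h - 1)) + c"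
  shows "finite (circle_walks n m \<eta> k) \<and> real (card (circle_walks n m \<eta> k)) = sgn (vand x) * signed_walks k x"
  using assms
proof (induction k arbitrary: \<eta> x c)
  case (0 \<eta> x c)
  show ?case
  proof (cases "vand x = 0")
    case True
    then show ?thesis using circle_walks_collision[OF 0 True] by simp
  next
    case False
    have "\<not> [\<eta> h = \<eta> t] (rmod real m)" if "h \<in> {1..n}" "t \<in> {1..n}" "h \<noteq> t" for h t
      using no_collision[OF 0 False that] .
    then have "circle_walks n m \<eta> 0 = {\<lambda>i\<in>{0}. restrict \<eta> {1..n}}"
      by (rule circle_walks_0)
    then show ?thesis using False by (simp add: sgn_if)
  qed
next
  case (Suc k \<eta> x c)
  show ?case
  proof (cases "vand x = 0")
    case True
    then show ?thesis using circle_walks_collision[OF Suc.prems True] by simp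
  next
    case False
    let ?C = "\<lambda>E. circle_walks n m (diagonal_step E \<eta>) k" and ?x = "\<lambda>E i. x i + of_bool (i \<in> E)"
    have "diagonal_step E \<eta> h = of_int (?x E (h - 1)) + (c - 1 / 2)" if "h \<in> {1..n}" for E h
      using Suc.prems[OF that] by (simp add: diagonal_step_def)
    then have IH: "finite (?C E)" "real (card (?C E)) = sgn (vand (?x E)) * signed_walks k (?x E)" for E
      using Suc.IH[of "diagonal_step E \<eta>" "?x E" "c - 1 / 2"] by blast+
    have "\<not> [\<eta> h = \<eta> t] (rmod real m)" if "h \<in> {1..n}" "t \<in> {1..n}" "h \<noteq> t" for h t
      using no_collision[OF Suc.prems False that] .
    note bij = bij_betw_circle_walks_Suc[of n \<eta> m k, OF this]
    have fin: "finite (SIGMA E : Pow {..<n}. ?C E)"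
      using IH by (intro finite_SigmaI) auto
    have "real (card (circle_walks n m \<eta> (Suc k))) = (\<Sum>E\<in>Pow {..<n}. real (card (?C E)))"
    proof -
      have "card (SIGMA E : Pow {..<n}. ?C E) = (\<Sum>E\<in>Pow {..<n}. card (?C E))"
        using IH(1) by (intro card_SigmaI) auto
      then show ?thesis using bij_betw_same_card[OF bij] by (simp flip: of_nat_sum)
    qed
    also have "\<dots> = sgn (vand x) * signed_walks (Suc k) x"
      by (simp add: IH(2) sgn_vand_step[OF False] sum_distrib_left)
    finally show ?thesis using bij_betw_finite[OF bij] fin by simp
  qed
qed

end

section \<open>Fourier expansion\<close>

lemma sgn_of_prod: "sgn (\<Prod>x\<in>A. f x :: real) = (\<Prod>x\<in>A. sgn (f x))"
  by (induction A rule: infinite_finite_induct) (simp_all add: sgn_mult)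

context circle
begin

abbreviation (input) boxes :: "(nat \<Rightarrow> int) set" where
  "boxes \<equiv> {..<n} \<rightarrow>\<^sub>E {0..<int m}"

abbreviation (input) modes :: "(nat \<Rightarrow> nat) set" where
  "modes \<equiv> {..<n} \<rightarrow>\<^sub>E {..<m}"

text \<open>The discrete Fourier transform over one period in each coordinate; a wave at
  \<open>- y i\<close> is the conjugate of the wave at \<open>y i\<close>.\<close>

definition fourier_coeff :: "(nat \<Rightarrow> nat) \<Rightarrow> complex" where
  "fourier_coeff u = (\<Sum>y\<in>boxes. of_real (sgn (vand y)) * (\<Prod>i<n. wave (u i) (- y i))) / of_nat m ^ n"

text \<open>Orthogonality by summing over momenta at a fixed displacement: consecutive momenta
  differ by 1, so the terms are geometric in \<open>u\<close>.\<close>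

lemma sum_wave:
  "(\<Sum>u<m. wave u d) = (if int m dvd d then of_nat m * of_int (twist (d div int m)) else 0)"
proof (cases "int m dvd d")
  case True
  then obtain q where "d = int m * q" by (auto elim: dvdE)
  then show ?thesis using m_pos by (simp add: wave_period)
next
  case False
  let ?z = "cis (2 * pi * of_int d / m)"
  have w: "wave u d = wave 0 d * ?z ^ u" for u
  proof -
    have "2 * pi * momentum u * of_int d / real m = 2 * pi * momentum 0 * of_int d / real m + real u * (2 * pi * of_int d / m)"
    proof -
      have mu: "momentum u = momentum 0 + real u" by (simp add: momentum_def)
      show ?thesis unfolding mu by (simp add: add_divide_distrib distrib_left distrib_right mult_ac)
    qed
    then show ?thesis by (simp only: wave_def DeMoivre cis_mult)
  qed
  have "(\<Sum>u<m. ?z ^ u) = 0"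
  proof (rule sum_root_of_unity)
    have "?z ^ m = cis (2 * pi * of_int d)" using m_pos by (simp add: DeMoivre)
    also have "\<dots> = 1" by (rule cis_multiple_2pi) simp
    finally show "?z ^ m = 1" .
    show "?z \<noteq> 1"
    proof
      assume "?z = 1"
      then obtain k :: int where "real_of_int d = of_int k * real m"
        using cis_eq_1_imp_multiple m_pos by blast
      then have "d = k * int m" by (metis of_int_eq_iff of_int_mult of_int_of_nat_eq)
      then show False using False by simp
    qed
  qed
  then have "(\<Sum>u<m. wave 0 d * ?z ^ u) = 0" by (simp flip: sum_distrib_left)
  then show ?thesis unfolding w[symmetric] using False by simp
qed

text \<open>Orthogonality selects the representative \<open>x'\<close> of \<open>x\<close> in the
  box. The twists of the waves between \<open>x'\<close> and \<open>x\<close> are those of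
  \<open>vand\<close>, so the inversion formula holds on all integer points.\<close>

lemma sgn_vand_fourier:
  "of_real (sgn (vand x)) = (\<Sum>u\<in>modes. fourier_coeff u * (\<Prod>i<n. wave (u i) (x i)))"
proof -
  define x' where "x' = (\<lambda>i\<in>{..<n}. x i mod int m)"
  have x': "x' \<in> boxes" using m_pos by (auto simp: x'_def)
  have key: "(\<Sum>u\<in>modes. \<Prod>i<n. wave (u i) (- y i) * wave (u i) (x i))
      = (if y = x' then of_nat m ^ n * (\<Prod>i<n. of_int (twist (x i div int m))) else 0)" if y: "y \<in> boxes" for y
  proof -
    have "(\<Sum>u\<in>modes. \<Prod>i<n. wave (u i) (- y i) * wave (u i) (x i)) = (\<Prod>i<n. \<Sum>v<m. wave v (x i - y i))"
    proof -
      have "wave (u i) (- y i) * wave (u i) (x i) = wave (u i) (x i - y i)" for u i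
        using wave_add[of "u i" "- y i" "x i"] by simp
      then show ?thesis by (simp only:) (rule prod_sum_PiE[symmetric], simp_all)
    qed
    also have "\<dots> = (if y = x' then of_nat m ^ n * (\<Prod>i<n. of_int (twist (x i div int m))) else 0)"
    proof (cases "y = x'")
      case True
      have "x i - y i = int m * (x i div int m)" if "i < n" for i
        using that by (simp add: True x'_def minus_mod_eq_mult_div)
      then have "(\<Sum>v<m. wave v (x i - y i)) = of_nat m * of_int (twist (x i div int m))" if "i < n" for i
        using that m_pos by (simp add: wave_period)
      then show ?thesis using True by (simp add: prod.distrib)
    next
      case False
      then obtain i where i: "i < n" "y i \<noteq> x' i"
        using y x' by (metis PiE_ext lessThan_iff)
      have "\<not> int m dvd x i - y i"
      proof
        assume "int m dvd x i - y i"
        then have "x i mod int m = y i mod int m" by (simp add: mod_eq_dvd_iff)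
        moreover have "y i mod int m = y i" using PiE_mem[OF y, of i] i by simp
        ultimately show False using i by (simp add: x'_def)
      qed
      then have "(\<Prod>i<n. \<Sum>v<m. wave v (x i - y i)) = 0"
        using i by (intro prod_zero) (auto simp: sum_wave intro!: bexI[of _ i])
      then show ?thesis using False by simp
    qed
    finally show ?thesis .
  qed
  have "(\<Sum>u\<in>modes. fourier_coeff u * (\<Prod>i<n. wave (u i) (x i)))
    = (\<Sum>u\<in>modes. \<Sum>y\<in>boxes. of_real (sgn (vand y)) * (\<Prod>i<n. wave (u i) (- y i) * wave (u i) (x i)) / of_nat m ^ n)"
    unfolding fourier_coeff_def sum_distrib_right sum_divide_distrib prod.distrib
    by (intro sum.cong refl) simp
  also have "\<dots> = (\<Sum>y\<in>boxes. of_real (sgn (vand y)) * (\<Sum>u\<in>modes. \<Prod>i<n. wave (u i) (- y i) * wave (u i) (x i)) / of_nat m ^ n)"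
    by (subst sum.swap) (simp only: sum_distrib_left sum_divide_distrib)
  also have "\<dots> = (\<Sum>y\<in>boxes. if y = x' then of_real (sgn (vand y)) * (\<Prod>i<n. of_int (twist (x i div int m))) else 0)"
    using m_pos by (intro sum.cong refl) (simp only: key, simp)
  also have "\<dots> = of_real (sgn (vand x')) * (\<Prod>i<n. of_int (twist (x i div int m)))"
    using x' by (subst sum.delta) (auto intro: finite_PiE)
  \<comment> \<open>With no steps, \<open>signed_walks_period\<close> is the quasi-periodicity of
    \<open>sgn (vand x)\<close>.\<close>
  also have "\<dots> = of_real (signed_walks 0 (\<lambda>i. x' i + int m * (x i div int m)))"
    unfolding signed_walks_period by (simp add: mult.commute)
  also have "\<dots> = of_real (sgn (vand x))"
  proof -
    have "vand (\<lambda>i. x' i + int m * (x i div int m)) = vand x"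
      unfolding vand_def by (intro prod.cong refl) (simp add: x'_def)
    then show ?thesis by simp
  qed
  finally show ?thesis by simp
qed

text \<open>Plane waves are eigenfunctions of one free step: each coordinate stays or moves by 1
  independently, so the eigenvalue is a product of factors \<open>1 + wave (u i) 1\<close>.\<close>

lemma signed_walks_fourier:
  "of_real (signed_walks k x)
    = (\<Sum>u\<in>modes. fourier_coeff u * (\<Prod>i<n. 1 + wave (u i) 1) ^ k * (\<Prod>i<n. wave (u i) (x i)))"
proof (induction k arbitrary: x)
  case 0
  show ?case by (simp add: sgn_vand_fourier)
next
  case (Suc k)
  have step: "(\<Sum>E\<in>Pow {..<n}. \<Prod>i<n. wave (u i) (x i + of_bool (i \<in> E)))
      = (\<Prod>i<n. 1 + wave (u i) 1) * (\<Prod>i<n. wave (u i) (x i))" for u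
  proof -
    have "(\<Prod>i\<in>E. wave (u i) 1) * (\<Prod>i\<in>{..<n} - E. 1) = (\<Prod>i<n. wave (u i) (of_bool (i \<in> E)))"
      if "E \<in> Pow {..<n}" for E
    proof -
      have "(\<Prod>i<n. wave (u i) (of_bool (i \<in> E))) = (\<Prod>i\<in>E. wave (u i) (of_bool (i \<in> E)))"
        using that by (intro prod.mono_neutral_right) auto
      then show ?thesis by simp
    qed
    then have "(\<Prod>i<n. wave (u i) 1 + 1) = (\<Sum>E\<in>Pow {..<n}. \<Prod>i<n. wave (u i) (of_bool (i \<in> E)))"
      by (subst prod_add) (auto intro!: sum.cong)
    then show ?thesis
      by (simp add: wave_add prod.distrib sum_distrib_left sum_distrib_right add.commute mult.commute)
  qed
  have "of_real (signed_walks (Suc k) x) = (\<Sum>u\<in>modes. fourier_coeff u * (\<Prod>i<n. 1 + wave (u i) 1) ^ k *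
     (\<Sum>E\<in>Pow {..<n}. \<Prod>i<n. wave (u i) (x i + of_bool (i \<in> E))))"
    unfolding signed_walks.simps of_real_sum Suc.IH
    by (subst sum.swap) (simp only: sum_distrib_left)
  then show ?case unfolding step by (simp add: mult_ac)
qed

lemma fourier_coeff_permute:
  assumes "\<tau> permutes {..<n}"
  shows "fourier_coeff (u \<circ> \<tau>) = of_int (sign \<tau>) * fourier_coeff u"
proof -
  have im: "\<tau> i < n \<longleftrightarrow> i < n" for i using permutes_in_image[OF assms, of i] by simp
  \<comment> \<open>Fixing the indices outside the range keeps the composites extensional, hence in
    the box.\<close>
  have out: "\<tau> i = i" if "\<not> i < n" for i using permutes_not_in[OF assms, of i] that by simp
  have inv: "Hilbert_Choice.inv \<tau> permutes {..<n}" by (rule permutes_inv[OF assms])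
  have im': "Hilbert_Choice.inv \<tau> i < n \<longleftrightarrow> i < n" for i using permutes_in_image[OF inv, of i] by simp
  have out': "Hilbert_Choice.inv \<tau> i = i" if "\<not> i < n" for i using permutes_not_in[OF inv, of i] that by simp
  have comp: "(y \<circ> \<tau>) \<circ> Hilbert_Choice.inv \<tau> = y" "(y \<circ> Hilbert_Choice.inv \<tau>) \<circ> \<tau> = y" for y :: "nat \<Rightarrow> int"
    using permutes_inv_o[OF assms] by (simp_all add: comp_assoc)
  have "(\<Sum>y\<in>boxes. of_real (sgn (vand y)) * (\<Prod>i<n. wave ((u \<circ> \<tau>) i) (- y i)))
      = (\<Sum>y\<in>boxes. of_real (sgn (vand (y \<circ> \<tau>))) * (\<Prod>i<n. wave ((u \<circ> \<tau>) i) (- (y \<circ> \<tau>) i)))"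
    by (rule sum.reindex_bij_witness[of _ "\<lambda>y. y \<circ> \<tau>" "\<lambda>y. y \<circ> Hilbert_Choice.inv \<tau>"])
      (auto simp: comp PiE_def extensional_def Pi_def im im' out out')
  also have "\<dots> = (\<Sum>y\<in>boxes. of_int (sign \<tau>) * (of_real (sgn (vand y)) * (\<Prod>i<n. wave (u i) (- y i))))"
  proof (intro sum.cong refl)
    fix y
    have "(\<Prod>i<n. wave ((u \<circ> \<tau>) i) (- (y \<circ> \<tau>) i)) = (\<Prod>i<n. wave (u i) (- y i))"
      using prod.permute[OF assms, of "\<lambda>i. wave (u i) (- y i)"] by (simp add: o_def)
    moreover have "sgn (vand (y \<circ> \<tau>)) = of_int (sign \<tau>) * sgn (vand y)"
      using signed_walks_permute[OF assms, of 0 y] by simp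
    ultimately show "of_real (sgn (vand (y \<circ> \<tau>))) * (\<Prod>i<n. wave ((u \<circ> \<tau>) i) (- (y \<circ> \<tau>) i))
      = of_int (sign \<tau>) * (of_real (sgn (vand y)) * (\<Prod>i<n. wave (u i) (- y i)))"
      by simp
  qed
  finally show ?thesis by (simp add: fourier_coeff_def sum_distrib_left)
qed

text \<open>Exchanging two equal momenta leaves \<open>u\<close> fixed but reverses the coefficient
  by antisymmetry.\<close>

lemma fourier_coeff_not_inj:
  assumes "\<not> inj_on u {..<n}"
  shows "fourier_coeff u = 0"
proof -
  obtain i j where ij: "i < n" "j < n" "i \<noteq> j" "u i = u j"
    using assms by (auto simp: inj_on_def)
  let ?\<tau> = "Transposition.transpose i j"
  have "?\<tau> permutes {..<n}" using ij by (intro permutes_swap_id) auto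
  moreover have "u \<circ> ?\<tau> = u" using ij by (auto simp: fun_eq_iff Transposition.transpose_def)
  ultimately show ?thesis using fourier_coeff_permute[of ?\<tau> u] ij by (simp add: sign_swap_id)
qed

text \<open>In the box all differences lie strictly between \<open>-m\<close> and \<open>m\<close>,
  where the sine has the sign of its argument.\<close>

lemma fourier_coeff_eq_sgn_prod_sum:
  "fourier_coeff (\<lambda>i. i) = sgn_prod_sum {0..<int m} (\<lambda>i d. wave i (- d)) {..<n} / of_nat m ^ n"
proof -
  have "sgn (vand y) = of_int (sgn_prod y {..<n})" if y: "y \<in> boxes" for y
  proof -
    have s: "sgn (sin (pi * of_int (y i - y j) / m)) = of_int (sgn (y i - y j))" if "i < n" "j < n" for i j
    proof -
      have pos: "sin (pi * of_int d / m) > 0" if "0 < d" "d < int m" for d :: int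
      proof (rule sin_gt_zero)
        have "real_of_int d < real m" using that by linarith
        then show "pi * of_int d / m < pi" using m_pos by (simp add: field_simps)
      qed (use that m_pos in simp)
      have "y i \<in> {0..<int m}" "y j \<in> {0..<int m}" using PiE_mem[OF y] that by auto
      then consider "y i = y j" | "0 < y i - y j" "y i - y j < int m" | "0 < y j - y i" "y j - y i < int m"
        by force
      then show ?thesis
      proof cases
        case 3
        have "sin (pi * of_int (y i - y j) / m) = - sin (pi * of_int (y j - y i) / m)"
        proof -
          have "pi * of_int (y i - y j) / m = - (pi * of_int (y j - y i) / m)"
            by (simp add: right_diff_distrib diff_divide_distrib)
          then show ?thesis by (simp only: sin_minus)
        qed
        then show ?thesis using pos[OF 3] 3 by simp
      next
        case 2
        then show ?thesis using pos[OF 2] by simp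
      qed simp
    qed
    have "sgn (vand y) = (\<Prod>i<n. \<Prod>j\<in>{i<..<n}. sgn (sin (pi * of_int (y i - y j) / m)))"
      unfolding vand_def by (simp add: sgn_of_prod)
    also have "\<dots> = (\<Prod>i<n. \<Prod>j\<in>{j \<in> {..<n}. i < j}. of_int (sgn (y i - y j)))"
      by (intro prod.cong) (auto simp: s simp del: of_int_diff)
    finally show ?thesis by (simp add: sgn_prod_def)
  qed
  then show ?thesis
    unfolding fourier_coeff_def sgn_prod_sum_def by simp
qed

end

section \<open>The dominant mode\<close>

text \<open>The common factors are positive and drop out. The equally many remaining ones lie below
  \<open>b\<close> in \<open>U\<close> and not below \<open>b\<close> in \<open>A\<close>.\<close>

lemma prod_less_prod_of_top_set:
  fixes g :: "'a \<Rightarrow> real"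
  assumes "finite A" "finite U" "card U = card A" "U \<noteq> A"
    and nonneg: "\<And>i. i \<in> U \<Longrightarrow> 0 \<le> g i" and small: "\<And>i. i \<in> U - A \<Longrightarrow> g i < b"
    and large: "\<And>i. i \<in> A \<Longrightarrow> b \<le> g i" and b: "0 < b"
  shows "(\<Prod>i\<in>U. g i) < (\<Prod>i\<in>A. g i)"
proof -
  have card: "card (U - A) = card (A - U)"
    using assms(1-3) by (simp add: card_Diff_subset_Int Int_commute)
  have "U - A \<noteq> {}"
    using assms(1-4) by (metis Diff_eq_empty_iff card_subset_eq)
  then obtain j where j: "j \<in> U - A" by blast
  have "0 \<le> g i \<and> g i \<le> b" if "i \<in> U - A" for i
    using nonneg[of i] small[OF that] that by auto
  then have "(\<Prod>i\<in>U - A. g i) < (\<Prod>i\<in>U - A. b)"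
    using assms(2) b by (intro prod_mono_strict[where i = j]) (use j small in auto)
  also have "\<dots> = (\<Prod>i\<in>A - U. b)" by (simp add: card)
  also have "\<dots> \<le> (\<Prod>i\<in>A - U. g i)"
    using large b by (intro prod_mono) (auto intro: less_imp_le)
  finally have less: "(\<Prod>i\<in>U - A. g i) < (\<Prod>i\<in>A - U. g i)" .
  have "0 < (\<Prod>i\<in>U \<inter> A. g i)"
    using large b by (intro prod_pos) force
  then have "(\<Prod>i\<in>U \<inter> A. g i) * (\<Prod>i\<in>U - A. g i) < (\<Prod>i\<in>U \<inter> A. g i) * (\<Prod>i\<in>A - U. g i)"
    using less by simp
  moreover have "(\<Prod>i\<in>U. g i) = (\<Prod>i\<in>U \<inter> A. g i) * (\<Prod>i\<in>U - A. g i)"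
    using assms(2) by (subst prod.Int_Diff[of U _ A]) auto
  moreover have "(\<Prod>i\<in>A. g i) = (\<Prod>i\<in>U \<inter> A. g i) * (\<Prod>i\<in>A - U. g i)"
    using assms(1) by (subst prod.Int_Diff[of A _ U]) (auto simp: Int_commute)
  ultimately show ?thesis by simp
qed

section \<open>Phases of the leading constant\<close>

lemma choose_two_add_two: "(k + 2) choose 2 = (k choose 2) + (2 * k + 1)"
  by (simp add: numeral_2_eq_2)

text \<open>The phases of the \<open>p\<close> cotangent factors cancel those of the Slater
  determinant. Raising \<open>p\<close> by 1 adds \<open>4 * p + 1\<close> to the exponent of
  \<open>- \<i>\<close>, whose fourth power is 1.\<close>

lemma neg_ii_power_choose_even: "\<i> ^ p * (- \<i>) ^ ((2 * p) choose 2) = 1"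
proof (induction p)
  case (Suc p)
  have four: "(- \<i>) ^ 4 = 1" by (simp add: power4_eq_xxxx)
  have "2 * Suc p = 2 * p + 2" "2 * (2 * p) + 1 = 4 * p + 1" by simp_all
  then have "(2 * Suc p) choose 2 = ((2 * p) choose 2) + (4 * p + 1)"
    by (simp only: choose_two_add_two)
  then have "(- \<i>) ^ ((2 * Suc p) choose 2) = (- \<i>) ^ ((2 * p) choose 2) * - \<i>"
    by (simp only: power_add power_mult four power_one power_one_right mult_1_left)
  then have "\<i> ^ Suc p * (- \<i>) ^ ((2 * Suc p) choose 2) = (\<i> ^ p * (- \<i>) ^ ((2 * p) choose 2)) * (\<i> * - \<i>)"
    by (simp only: power_Suc mult_ac)
  then show ?case unfolding Suc.IH by simp
qed (simp add: numeral_2_eq_2)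

text \<open>Here \<open>(- 1) ^ p\<close> comes from the position of the zero momentum, and the
  exponent grows by \<open>4 * p + 3\<close>.\<close>

lemma neg_ii_power_choose_odd: "(- 1) ^ p * \<i> ^ p * (- \<i>) ^ ((2 * p + 1) choose 2) = 1"
proof (induction p)
  case (Suc p)
  have four: "(- \<i>) ^ 4 = 1" by (simp add: power4_eq_xxxx)
  have three: "(- \<i>) ^ 3 = \<i>" by (simp add: power3_eq_cube)
  have "2 * Suc p + 1 = (2 * p + 1) + 2" "2 * (2 * p + 1) + 1 = 4 * p + 3" by simp_all
  then have "(2 * Suc p + 1) choose 2 = ((2 * p + 1) choose 2) + (4 * p + 3)"
    by (simp only: choose_two_add_two)
  then have E: "(- \<i>) ^ ((2 * Suc p + 1) choose 2) = (- \<i>) ^ ((2 * p + 1) choose 2) * \<i>"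
    by (simp only: power_add power_mult four three power_one mult_1_left)
  have rearrange: "(a * A) * (b * B) * (X * b) = (A * B * X) * (a * (b * b))" for a A b B X :: complex
    by (simp add: mult_ac)
  have "(- 1) ^ Suc p * \<i> ^ Suc p * (- \<i>) ^ ((2 * Suc p + 1) choose 2)
      = ((- 1) ^ p * \<i> ^ p * (- \<i>) ^ ((2 * p + 1) choose 2)) * (- 1 * (\<i> * \<i>))"
    unfolding E power_Suc by (rule rearrange)
  then show ?case unfolding Suc.IH by simp
qed (simp add: numeral_2_eq_2)

context circle
begin

lemma wave_1_add_1: "1 + wave u 1 = of_real (2 * cos (pi * momentum u / m)) * cis (pi * momentum u / m)"
proof -
  define \<theta> where "\<theta> = pi * momentum u / m"
  have "wave u 1 = cis (\<theta> + \<theta>)" by (simp add: wave_def \<theta>_def mult.assoc)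
  then have "1 + wave u 1 = cis \<theta> * cis (- \<theta>) + cis \<theta> * cis \<theta>" by (simp add: cis_mult)
  also have "\<dots> = of_real (2 * cos \<theta>) * cis \<theta>" by (simp add: complex_eq_iff algebra_simps)
  finally show ?thesis by (simp only: \<theta>_def)
qed

lemma sum_momentum: "(\<Sum>u<n. momentum u) = 0"
proof -
  have "(\<Sum>u<k. real u) = real k * (real k - 1) / 2" for k
    by (induction k) (simp_all add: field_simps)
  then show ?thesis by (simp add: momentum_def sum_subtractf)
qed

definition growth :: real where
  "growth = (\<Prod>u<n. 2 * cos (pi * momentum u / m))"

text \<open>The half-angle phases multiply to 1 because the centred momenta sum to 0; the cosines
  remain.\<close>

lemma prod_wave_1_add_1: "(\<Prod>u<n. 1 + wave u 1) = of_real growth"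
proof -
  have "(\<Prod>u\<in>A. cis (f u)) = cis (\<Sum>u\<in>A. f u)" if "finite A" for A and f :: "nat \<Rightarrow> real"
    using that by induction (simp_all add: cis_mult)
  then have "(\<Prod>u<n. cis (pi * momentum u / m)) = 1"
    by (simp add: sum_momentum flip: sum_distrib_left sum_divide_distrib)
  then show ?thesis by (simp add: wave_1_add_1 growth_def prod.distrib)
qed

text \<open>The bound is the cosine at the extreme momenta \<open>(n - 1) / 2\<close> and its
  negative; it is positive since \<open>n - 1 < m\<close>. It serves as the threshold separating the
  lowest \<open>n\<close> momenta from the others.\<close>

lemma cos_momentum_ge:
  assumes "u < n"
  shows "cos (pi * (real n - 1) / (2 * m)) \<le> cos (pi * momentum u / m)" and "0 < cos (pi * (real n - 1) / (2 * m))"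
proof -
  have "\<bar>momentum u\<bar> \<le> (real n - 1) / 2" using assms by (auto simp: momentum_def abs_if field_simps)
  then have "pi * \<bar>momentum u\<bar> / m \<le> pi * ((real n - 1) / 2) / m"
    by (intro divide_right_mono mult_left_mono) auto
  then have "\<bar>pi * momentum u / m\<bar> \<le> pi * (real n - 1) / (2 * m)" by (simp add: abs_mult)
  moreover have "pi * (real n - 1) / (2 * m) < pi / 2"
  proof -
    have "pi * (real n - 1) / (2 * m) < pi * m / (2 * m)"
      using n_le_m m_pos by (intro divide_strict_right_mono mult_strict_left_mono) auto
    then show ?thesis using m_pos by simp
  qed
  moreover have "0 \<le> pi * (real n - 1) / (2 * m)" using assms by simp
  ultimately have "cos (pi * (real n - 1) / (2 * m)) \<le> cos \<bar>pi * momentum u / m\<bar>"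
      and pos: "0 < cos (pi * (real n - 1) / (2 * m))"
    by - (rule cos_monotone_0_pi_le, linarith+, rule cos_gt_zero_pi, linarith+)
  then show "cos (pi * (real n - 1) / (2 * m)) \<le> cos (pi * momentum u / m)"
    by (simp only: cos_abs_real)
  show "0 < cos (pi * (real n - 1) / (2 * m))" by (rule pos)
qed

text \<open>For these \<open>u\<close> the angle lies strictly between \<open>s\<close> and
  \<open>pi - s\<close>, where \<open>s\<close> is the angle of the threshold.\<close>

lemma abs_cos_momentum_less:
  assumes "n \<le> u" "u < m" "n > 0"
  shows "\<bar>cos (pi * momentum u / m)\<bar> < cos (pi * (real n - 1) / (2 * m))"
proof -
  define s where "s = pi * (real n - 1) / (2 * m)"
  define t where "t = pi * momentum u / m"
  have u: "real n \<le> real u" "real u + 1 \<le> m" using assms by auto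
  then have "(real n - 1) / 2 < momentum u" by (simp add: momentum_def field_simps)
  then have "pi * ((real n - 1) / 2) / m < pi * momentum u / m"
    using m_pos by (intro divide_strict_right_mono mult_strict_left_mono) auto
  then have st: "s < t" by (simp add: s_def t_def)
  have "momentum u < m - (real n - 1) / 2" using u by (simp add: momentum_def field_simps)
  then have "pi * momentum u / m < pi * (m - (real n - 1) / 2) / m"
    using m_pos by (intro divide_strict_right_mono mult_strict_left_mono) auto
  also have "\<dots> = pi - s" using m_pos by (simp add: s_def field_simps)
  finally have ts: "t < pi - s" by (simp add: t_def)
  have "0 \<le> s" using assms by (simp add: s_def)
  then have "cos t < cos s"
    using st ts by (intro cos_monotone_0_pi) auto
  moreover have "cos (pi - s) < cos t"
    using st ts \<open>0 \<le> s\<close> by (intro cos_monotone_0_pi) auto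
  ultimately have "\<bar>cos t\<bar> < cos s" by (simp add: abs_less_iff)
  then show ?thesis by (simp only: s_def t_def)
qed

lemma growth_pos: "growth > 0"
  unfolding growth_def using cos_momentum_ge by (intro prod_pos) (force intro: less_le_trans)

lemma norm_prod_wave_less:
  assumes u: "u \<in> modes" and inj: "inj_on u {..<n}" and image: "u ` {..<n} \<noteq> {..<n}"
  shows "norm (\<Prod>i<n. 1 + wave (u i) 1) < growth"
proof -
  have n: "n > 0" using image by (cases "n = 0") auto
  define g where "g = (\<lambda>u. \<bar>2 * cos (pi * momentum u / m)\<bar>)"
  have g: "norm (1 + wave v 1) = g v" for v
    by (simp add: wave_1_add_1 g_def norm_mult abs_mult)
  have "norm (\<Prod>i<n. 1 + wave (u i) 1) = (\<Prod>v\<in>u ` {..<n}. g v)"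
    using inj by (simp add: prod_norm[symmetric] g prod.reindex)
  also have "\<dots> < (\<Prod>v<n. g v)"
  proof (rule prod_less_prod_of_top_set)
    show "card (u ` {..<n}) = card {..<n}" using inj by (simp add: card_image)
    show "g v < 2 * cos (pi * (real n - 1) / (2 * m))" if "v \<in> u ` {..<n} - {..<n}" for v
      using abs_cos_momentum_less[of v] that u n by (auto simp: g_def abs_mult not_less)
    show "2 * cos (pi * (real n - 1) / (2 * m)) \<le> g v" if "v \<in> {..<n}" for v
      using cos_momentum_ge(1)[of v] that by (auto simp: g_def)
    show "0 < 2 * cos (pi * (real n - 1) / (2 * m))" using cos_momentum_ge(2)[OF n] by simp
  qed (use image in \<open>auto simp: g_def\<close>)
  also have "(\<Prod>v<n. g v) = growth"
    unfolding growth_def g_def using cos_momentum_ge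
    by (intro prod.cong refl abs_of_nonneg) (force intro: less_imp_le less_le_trans)
  finally show ?thesis .
qed

text \<open>After division by \<open>growth ^ k\<close>, modes with repeated momenta are absent and
  modes with another set of momenta decay geometrically. What remains are the permutations of the
  centred momenta, with ratio 1; by antisymmetry they add up to the Slater determinant.\<close>

lemma signed_walks_limit_complex:
  "(\<lambda>k. complex_of_real (signed_walks k x / growth ^ k))
    \<longlonglongrightarrow> fourier_coeff (\<lambda>i. i) * ((- 2 * \<i>) ^ (n choose 2) * of_real (vand x))"
proof -
  let ?P = "\<lambda>u. \<Prod>i<n. 1 + wave (u i) 1" and ?w = "\<lambda>u. \<Prod>i<n. wave (u i) (x i)"
  let ?D = "{u \<in> modes. inj_on u {..<n} \<and> u ` {..<n} = {..<n}}"
  have fin: "finite modes" by (intro finite_PiE) auto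
  have "(\<lambda>k. fourier_coeff u * ?w u * (?P u / of_real growth) ^ k)
      \<longlonglongrightarrow> (if u \<in> ?D then fourier_coeff u * ?w u else 0)" if u: "u \<in> modes" for u
  proof (cases "inj_on u {..<n}")
    case inj: True
    show ?thesis
    proof (cases "u ` {..<n} = {..<n}")
      case True
      have "?P u = (\<Prod>v\<in>u ` {..<n}. 1 + wave v 1)" using inj by (simp add: prod.reindex)
      then have "?P u = of_real growth" using True prod_wave_1_add_1 by simp
      then show ?thesis using u inj True growth_pos by simp
    next
      case False
      have "norm (?P u / of_real growth) < 1"
        using norm_prod_wave_less[OF u inj False] growth_pos by (simp add: norm_divide)
      then have "(\<lambda>k. fourier_coeff u * ?w u * (?P u / of_real growth) ^ k) \<longlonglongrightarrow> fourier_coeff u * ?w u * 0"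
        by (intro tendsto_mult_left LIMSEQ_power_zero)
      then show ?thesis using False by simp
    qed
  next
    case False
    then show ?thesis by (simp add: fourier_coeff_not_inj)
  qed
  then have "(\<lambda>k. \<Sum>u\<in>modes. fourier_coeff u * ?w u * (?P u / of_real growth) ^ k)
      \<longlonglongrightarrow> (\<Sum>u\<in>modes. if u \<in> ?D then fourier_coeff u * ?w u else 0)"
    by (intro tendsto_sum)
  moreover have "complex_of_real (signed_walks k x / growth ^ k)
      = (\<Sum>u\<in>modes. fourier_coeff u * ?w u * (?P u / of_real growth) ^ k)" for k
    by (simp add: signed_walks_fourier sum_divide_distrib power_divide mult_ac)
  moreover have "(\<Sum>u\<in>modes. if u \<in> ?D then fourier_coeff u * ?w u else 0)
      = fourier_coeff (\<lambda>i. i) * ((- 2 * \<i>) ^ (n choose 2) * of_real (vand x))"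
  proof -
    have "(\<Sum>u\<in>modes. if u \<in> ?D then fourier_coeff u * ?w u else 0) = (\<Sum>u\<in>?D. fourier_coeff u * ?w u)"
      using fin by (simp add: sum.inter_filter)
    also have "\<dots> = (\<Sum>\<sigma> | \<sigma> permutes {..<n}. fourier_coeff (\<lambda>i. i) * (of_int (sign \<sigma>) * ?w \<sigma>))"
    \<comment> \<open>Modes are undefined outside \<open>{..<n}\<close> while permutations are the
      identity there; the witnesses translate between the two conventions.\<close>
    proof (rule sum.reindex_bij_witness[of _ "\<lambda>\<sigma>. restrict \<sigma> {..<n}" "\<lambda>u i. if i < n then u i else i"])
      fix u assume u: "u \<in> ?D"
      show "restrict (\<lambda>i. if i < n then u i else i) {..<n} = u"
        using u by (auto simp: PiE_def extensional_def fun_eq_iff)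
      have "bij_betw u {..<n} {..<n}" using u by (simp add: bij_betw_def)
      then have bij: "bij_betw (\<lambda>i. if i < n then u i else i) {..<n} {..<n}"
        by (rule bij_betw_cong[THEN iffD1, rotated]) auto
      then have perm: "(\<lambda>i. if i < n then u i else i) permutes {..<n}"
        by (intro bij_imp_permutes) auto
      then show "(\<lambda>i. if i < n then u i else i) \<in> {\<sigma>. \<sigma> permutes {..<n}}" by simp
      have "fourier_coeff u = fourier_coeff ((\<lambda>i. i) \<circ> (\<lambda>i. if i < n then u i else i))"
        by (simp add: fourier_coeff_def o_def)
      then show "fourier_coeff (\<lambda>i. i) * (of_int (sign (\<lambda>i. if i < n then u i else i)) * ?w (\<lambda>i. if i < n then u i else i))
          = fourier_coeff u * ?w u"
        using fourier_coeff_permute[OF perm, of "\<lambda>i. i"] by simp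
    next
      fix \<sigma> assume "\<sigma> \<in> {\<sigma>. \<sigma> permutes {..<n}}"
      then have \<sigma>: "\<sigma> permutes {..<n}" by simp
      show "(\<lambda>i. if i < n then restrict \<sigma> {..<n} i else i) = \<sigma>"
        using permutes_not_in[OF \<sigma>] by (auto simp: fun_eq_iff)
      have "\<sigma> i < m" if "i < n" for i
        using permutes_in_image[OF \<sigma>, of i] that n_le_m by simp
      then show "restrict \<sigma> {..<n} \<in> ?D"
        using permutes_inj_on[OF \<sigma>] permutes_image[OF \<sigma>] by auto
    qed
    finally show ?thesis by (simp only: sum_distrib_left[symmetric] vand_slater)
  qed
  ultimately show ?thesis by simp
qed

definition leading_coeff :: real where
  "leading_coeff = 2 ^ (n choose 2) / real m ^ (n div 2)
    * (\<Prod>h=1..n div 2. cot (pi * (real h - (if even n then 1 / 2 else 0)) / m))"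

text \<open>Each pair of momenta supplies one factor \<open>m\<close>, and for odd \<open>n\<close>
  the zero momentum supplies another. Against \<open>m ^ n\<close> this leaves
  \<open>1 / m ^ (n div 2)\<close>, and all phases cancel.\<close>

lemma leading_coeff: "fourier_coeff (\<lambda>i. i) * (- 2 * \<i>) ^ (n choose 2) = of_real leading_coeff"
proof -
  define p where "p = n div 2"
  define C where "C = (\<Prod>h=1..p. cot (pi * (real h - (if even n then 1 / 2 else 0)) / m))"
  have split: "(- 2 * \<i>) ^ k = 2 ^ k * (- \<i>) ^ k" for k
    by (simp flip: power_mult_distrib)
  have prod: "(\<Prod>h=1..n div 2. of_nat m * \<i> * complex_of_real (cot (pi * (real h - (if even n then 1 / 2 else 0)) / m)))
      = of_nat m ^ p * \<i> ^ p * of_real C"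
    unfolding C_def p_def prod.distrib by simp
  have coeff: "fourier_coeff (\<lambda>i. i) = (if even n then 1 else (- 1) ^ p * of_nat m) * (of_nat m ^ p * \<i> ^ p * of_real C) / of_nat m ^ n"
    unfolding fourier_coeff_eq_sgn_prod_sum sgn_prod_sum_wave prod p_def ..
  have lead: "leading_coeff = 2 ^ (n choose 2) / real m ^ p * C"
    by (simp add: leading_coeff_def C_def p_def)
  show ?thesis
  proof (cases "even n")
    case True
    then have n: "n = 2 * p" by (simp add: p_def)
    have "fourier_coeff (\<lambda>i. i) * (- 2 * \<i>) ^ (n choose 2)
      = (\<i> ^ p * (- \<i>) ^ (n choose 2)) * (2 ^ (n choose 2) * (of_nat m ^ p / of_nat m ^ n) * of_real C)"
      unfolding coeff split using True by simp
    also have "\<i> ^ p * (- \<i>) ^ (n choose 2) = 1"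
      unfolding n by (rule neg_ii_power_choose_even)
    also have "(of_nat m ^ p / of_nat m ^ n :: complex) = 1 / of_nat m ^ p"
      unfolding n using m_pos by (simp add: mult_2 power_add)
    finally show ?thesis by (simp add: lead)
  next
    case False
    then have n: "n = 2 * p + 1" by (simp add: p_def)
    have "fourier_coeff (\<lambda>i. i) * (- 2 * \<i>) ^ (n choose 2)
      = ((- 1) ^ p * \<i> ^ p * (- \<i>) ^ (n choose 2)) * (2 ^ (n choose 2) * (of_nat m * of_nat m ^ p / of_nat m ^ n) * of_real C)"
      unfolding coeff split using False by simp
    also have "(- 1) ^ p * \<i> ^ p * (- \<i>) ^ (n choose 2) = 1"
      unfolding n by (rule neg_ii_power_choose_odd)
    also have "(of_nat m * of_nat m ^ p / of_nat m ^ n :: complex) = 1 / of_nat m ^ p"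
      unfolding n using m_pos by (simp add: mult_2 power_add)
    finally show ?thesis by (simp add: lead)
  qed
qed

lemma leading_coeff_pos: "leading_coeff > 0"
proof -
  have "cot (pi * (real h - (if even n then 1 / 2 else 0)) / m) > 0" if h: "h \<in> {1..n div 2}" for h
  proof (rule cot_gt_zero)
    define r where "r = real h - (if even n then 1 / 2 else 0)"
    have "2 * h \<le> n" "h \<ge> 1" "odd n \<Longrightarrow> 2 * h < n" using h by (auto elim: oddE)
    then have "0 < r" "2 * r < n" by (auto simp: r_def)
    then have r: "0 < r" "2 * r < m" using n_le_m by auto
    then show "0 < pi * (real h - (if even n then 1 / 2 else 0)) / m"
      using m_pos by (simp add: r_def[symmetric])
    show "pi * (real h - (if even n then 1 / 2 else 0)) / m < pi / 2"
      using m_pos r by (simp add: r_def[symmetric] field_simps)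
  qed
  then show ?thesis unfolding leading_coeff_def using m_pos
    by (intro mult_pos_pos prod_pos) auto
qed

lemma signed_walks_limit: "(\<lambda>k. signed_walks k x / growth ^ k) \<longlonglongrightarrow> leading_coeff * vand x"
proof -
  have "(\<lambda>k. complex_of_real (signed_walks k x / growth ^ k)) \<longlonglongrightarrow> complex_of_real (leading_coeff * vand x)"
    using signed_walks_limit_complex[of x] unfolding mult.assoc[symmetric] leading_coeff by simp
  then show ?thesis unfolding tendsto_of_real_iff .
qed

text \<open>Matches indices from 1 with indices from 0, where \<open>j - (n + 1) / 2\<close> becomes
  \<open>momentum (j - 1)\<close>. Only differences of coordinates enter, so \<open>c\<close>
  disappears.\<close>

lemma circle_walks_asymptotics_eq:
  assumes "\<And>h. h \<in> {1..n} \<Longrightarrow> \<eta> h = of_int (x (h - 1)) + c"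
  shows "circle_walks_asymptotics n m \<eta> k = leading_coeff * growth ^ k * vand x"
proof -
  have growth: "2 ^ n * (\<Prod>j=1..n. cos (pi * (real j - (real n + 1) / 2) / real m)) = growth"
  proof -
    have "(\<Prod>j=1..n. cos (pi * (real j - (real n + 1) / 2) / real m)) = (\<Prod>u<n. cos (pi * momentum u / m))"
      by (rule prod.reindex_bij_witness[of _ Suc "\<lambda>j. j - 1"])
        (auto simp: momentum_def of_nat_diff field_simps)
    then show ?thesis by (simp add: growth_def prod.distrib)
  qed
  have vand: "(\<Prod>h=1..n. \<Prod>t\<in>{h<..n}. sin (pi * (\<eta> h - \<eta> t) / real m)) = vand x"
    unfolding vand_def
  proof (rule prod.reindex_bij_witness[of _ Suc "\<lambda>j. j - 1"])
    fix h assume h: "h \<in> {1..n}"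
    show "(\<Prod>j\<in>{h - 1<..<n}. sin (pi * of_int (x (h - 1) - x j) / m)) = (\<Prod>t\<in>{h<..n}. sin (pi * (\<eta> h - \<eta> t) / real m))"
      by (rule prod.reindex_bij_witness[of _ "\<lambda>j. j - 1" Suc])
        (use h in \<open>auto simp: assms\<close>)
  qed auto
  have cot: "(\<Prod>h=1..n div 2. cot (pi * (real h - (if even n then 1 / 2 else 0)) / m)) =
     (if even n then \<Prod>h=1..n div 2. cot ((2 * real h - 1) * pi / (2 * real m))
      else \<Prod>h=1..(n - 1) div 2. cot (real h * pi / real m))"
  proof (cases "even n")
    case True
    have "pi * (real h - 1 / 2) / m = (2 * real h - 1) * pi / (2 * real m)" for h
      using m_pos by (simp add: field_simps)
    then show ?thesis using True by simp
  next
    case False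
    then have "(n - 1) div 2 = n div 2" by (auto elim: oddE)
    then show ?thesis using False by (simp add: mult.commute)
  qed
  have half: "(n - 1) div 2 = n div 2" if "odd n" using that by (auto elim: oddE)
  show ?thesis
    unfolding circle_walks_asymptotics_def growth vand leading_coeff_def cot using half
    by (simp add: mult_ac)
qed

end

theorem theorem20:
  fixes n m :: nat and \<eta> :: "nat \<Rightarrow> real"
  assumes "n \<ge> 1" and "m > 0"
    and "(\<forall>h\<in>{1..n}. \<eta> h \<in> \<int>) \<or> (\<forall>h\<in>{1..n}. half_integer (\<eta> h))"
    and "real m > \<eta> 1"
    and "\<forall>h\<in>{1..n}. \<forall>t\<in>{1..n}. h < t \<longrightarrow> \<eta> h > \<eta> t"
    and "\<eta> n \<ge> 0"
  shows "(\<lambda>k. real (card (circle_walks n m \<eta> k)) / circle_walks_asymptotics n m \<eta> k)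
           \<longlonglongrightarrow> 1"
proof -
  \<comment> \<open>The offset is 0 for integer coordinates and \<open>1/2\<close> for
    half-integers.\<close>
  obtain c where c: "\<forall>h\<in>{1..n}. \<eta> h - c \<in> \<int>"
    using assms(3)
  proof
    assume "\<forall>h\<in>{1..n}. \<eta> h \<in> \<int>"
    then show ?thesis using that[of 0] by simp
  next
    assume *: "\<forall>h\<in>{1..n}. half_integer (\<eta> h)"
    have "\<eta> h - 1 / 2 \<in> \<int>" if "h \<in> {1..n}" for h
    proof -
      obtain a :: int where "odd a" "\<eta> h = of_int a / 2" using * \<open>h \<in> {1..n}\<close> unfolding half_integer_def by blast
      then obtain b where "\<eta> h = of_int (2 * b + 1) / 2" by (metis oddE)
      then have "\<eta> h - 1 / 2 = of_int b" by simp
      then show ?thesis by simp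
    qed
    then show ?thesis using that[of "1 / 2"] by blast
  qed
  define x where "x = (\<lambda>i. \<lfloor>\<eta> (Suc i) - c\<rfloor>)"
  have x: "\<eta> h = of_int (x (h - 1)) + c" if "h \<in> {1..n}" for h
  proof -
    have "Suc (h - 1) = h" using that by simp
    then show ?thesis using c that unfolding x_def by (metis add.commute diff_add_cancel floor_of_int Ints_cases)
  qed
  have diff: "of_int (x i - x j) = \<eta> (Suc i) - \<eta> (Suc j)" if "i < n" "j < n" for i j
    using x[of "Suc i"] x[of "Suc j"] that by simp
  have range: "0 < x i - x j \<and> x i - x j < int m" if "i < j" "j < n" for i j
  proof -
    have "\<eta> (Suc j) < \<eta> (Suc i)" using assms(5) that by simp
    moreover have "\<eta> (Suc i) \<le> \<eta> 1" using assms(1,5) that by (cases "i = 0") (auto intro: less_imp_le)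
    moreover have "\<eta> n \<le> \<eta> (Suc j)" using assms(1,5) that by (cases "Suc j = n") (auto intro: less_imp_le)
    ultimately have "0 < real_of_int (x i - x j)" "real_of_int (x i - x j) < real m"
      using assms(4,6) that by (simp_all only: diff)
    then show ?thesis by linarith
  qed
  \<comment> \<open>Pigeonhole: the \<open>n\<close> distinct integers \<open>x i\<close> lie in a
    window of \<open>m\<close> consecutive integers starting at the smallest one,
    \<open>x (n - 1)\<close>.\<close>
  have "n \<le> m"
  proof -
    have "inj_on x {..<n}"
    proof (rule inj_onI)
      fix i j assume "i \<in> {..<n}" "j \<in> {..<n}" "x i = x j"
      then show "i = j" using range[of i j] range[of j i] by (cases i j rule: linorder_cases) auto
    qed
    moreover have "x ` {..<n} \<subseteq> {x (n - 1)..<x (n - 1) + int m}"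
    proof clarify
      fix i assume "i < n"
      then have "i = n - 1 \<or> i < n - 1" by linarith
      with \<open>i < n\<close> show "x i \<in> {x (n - 1)..<x (n - 1) + int m}"
        using range[of i "n - 1"] assms(2) by auto
    qed
    ultimately have "card {..<n} \<le> card {x (n - 1)..<x (n - 1) + int m}"
      by (intro card_inj_on_le) auto
    then show ?thesis by simp
  qed
  then interpret circle n m using assms(2) by unfold_locales
  have pos: "vand x > 0"
    unfolding vand_def
  proof (intro prod_pos ballI sin_gt_zero)
    fix i j assume "i \<in> {..<n}" "j \<in> {i<..<n}"
    then have r: "0 < x i - x j" "x i - x j < int m" using range[of i j] by auto
    then show "0 < pi * of_int (x i - x j) / real m" using m_pos by simp
    have "real_of_int (x i - x j) < real m" using r by linarith
    then show "pi * of_int (x i - x j) / real m < pi"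
      using m_pos by (simp add: pos_divide_less_eq del: of_int_diff)
  qed
  \<comment> \<open>Since \<open>vand x\<close> is positive, the sign in
    \<open>card_circle_walks\<close> is 1 and the count is \<open>signed_walks k x\<close> itself;
    the ratio is rewritten exactly for every \<open>k\<close> before taking the limit.\<close>
  have "real (card (circle_walks n m \<eta> k)) / circle_walks_asymptotics n m \<eta> k
      = (signed_walks k x / growth ^ k) / (leading_coeff * vand x)" for k
    using card_circle_walks[of \<eta> x c k, OF x] circle_walks_asymptotics_eq[of \<eta> x c k, OF x] pos growth_pos leading_coeff_pos
    by (simp add: field_simps)
  moreover have "(\<lambda>k. (signed_walks k x / growth ^ k) / (leading_coeff * vand x))
      \<longlonglongrightarrow> (leading_coeff * vand x) / (leading_coeff * vand x)"
    using pos leading_coeff_pos by (intro tendsto_divide tendsto_const signed_walks_limit) simp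
  ultimately show ?thesis using pos leading_coeff_pos by simp
qed

end
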